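(* Let $\tau,\sigma>0$, $\mu\in\mathbb{R}$, $\Delta>0$, and let $Y_0\ge 0$ be an initial value with finite second moment, independent of the Gaussian variables driving the schemes. For $i\in\mathbb{N}$, $i\ge 1$, let $\widetilde Y(t_i)$, $t_i=i\Delta$, be any one of the eight numerical solutions E, M, L1, L2, S1, S2, Lin, Log of the inhomogeneous geometric Brownian motion (recursions given in the context). Then the conditional mean and variance of $\widetilde Y(t_i)$ given $Y_0$ are $$\mathbb{E}[\widetilde Y(t_i)\,|\,Y_0]=Z_0\mu_x^i+c_1\mu_h\sum_{k=1}^{I}\mu_x^k+c_1W_0\mu_h+c_2,$$ $$\mathrm{Var}(\widetilde Y(t_i)\,|\,Y_0)=Z_0^2(r^i-\mu_x^{2i})+2c_1Z_0\sum_{k=0}^{I}\left(r^k\mu_x^{i-k}p-\mu_x^{i+k}\mu_h\right)+c_1^2\left[\sum_{k=0}^{I}\left(r^kr_h-\mu_x^{2k}\mu_h^2\right)+2\sum_{l=1}^{I}\sum_{k=0}^{l-1}\left(\mu_hr^k\mu_x^{l-k}p-\mu_x^{l+k}\mu_h^2\right)\right],$$ where $c_1=\mu\Delta$ for all schemes and the remaining quantities are: - E: $\mu_x=1-\frac{\Delta}{\tau}$, $\mu_h=1$, $r=\sigma^2\Delta+(1-\frac{\Delta}{\tau})^2$, $r_h=1$, $p=1$, $c_2=\mu\Delta$, $I=i-1$, $Z_0=Y_0$, $W_0=0$. - M: $\mu_x=1-\frac{\Delta}{\tau}$, $\mu_h=1$, $r=\sigma^2\Delta+(1-\frac{\Delta}{\tau})^2+\frac{(\sigma^2\Delta)^2}{2}$,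 $r_h=1$, $p=1$, $c_2=\mu\Delta$, $I=i-1$, $Z_0=Y_0$, $W_0=0$. For all of L1, L2, S1, S2, Lin, Log: $\mu_x=e^{-\Delta/\tau}$ and $r=e^{\sigma^2\Delta-2\Delta/\tau}$; moreover - L1: $\mu_h=r_h=p=1$, $c_2=0$, $I=i$, $Z_0=Y_0$, $W_0=0$. - L2: $\mu_h=r_h=p=1$, $c_2=0$, $I=i-1$, $Z_0=Y_0$, $W_0=1$. - S1: $\mu_h=r_h=p=1$, $c_2=\frac{\mu\Delta}{2}$, $I=i-1$, $Z_0=Y_0+\frac{\mu\Delta}{2}$, $W_0=0$. - S2: $\mu_h=\mu_x^{1/2}$, $r_h=r^{1/2}$, $p=r_h\mu_x^{-1/2}$, $c_2=0$, $I=i-1$, $Z_0=Y_0$, $W_0=1$. - Lin: $\mu_h=L$, $r_h=\bar L$, $p=\widetilde L$, $c_2=0$, $I=i-1$, $Z_0=Y_0$, $W_0=1$. - Log: $\mu_h=K$, $r_h=\bar K$, $p=\widetilde K$, $c_2=0$, $I=i-1$, $Z_0=Y_0$, $W_0=1$. Here $L,\bar L,\widetilde L,K,\bar K,\widetilde K$ are the explicit functions of $(\Delta,\tau,\sigma)$ given in the context.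
   Context: The inhomogeneous geometric Brownian motion is the solution of the Itô SDE $dY(t)=(-\frac1\tau Y(t)+\mu)dt+\sigma Y(t)dW(t)$, $Y(0)=Y_0$. Let $t_i=i\Delta$. The variables $\xi_0,\xi_1,\dots$ are iid $N(0,\Delta)$ (Wiener increments); $\rho_0,\rho_1,\dots$ are iid $N(0,\Delta/12)$ and independent of the $\xi$'s; $\varphi_0,\psi_0,\varphi_1,\psi_1,\dots$ are iid $N(0,\Delta/2)$; all are independent of $Y_0$. Put $a=\frac1\tau+\frac{\sigma^2}{2}$ and $X_{i-1}=e^{-a\Delta+\sigma\xi_{i-1}}$, and $\alpha_{i-1}=\dfrac{e^{-a\Delta+\sigma\xi_{i-1}}-1}{-a\Delta+\sigma\xi_{i-1}}$ (the denominator is nonzero almost surely). All schemes start at $\widetilde Y(t_0)=Y_0$ and, writing $y=\widetilde Y(t_{i-1})$ for the same scheme, are defined for $i\ge1$ by: E (Euler-Maruyama): $\widetilde Y(t_i)=y+\Delta(-\frac1\tau y+\mu)+\sigma y\,\xi_{i-1}$. M (Milstein): $\widetilde Y(t_i)=y+\Delta(-\frac1\tau y+\mu)+\sigma y\left(\xi_{i-1}+\frac\sigma2(\xi_{i-1}^2-\Delta)\right)$. L1 (first Lie-Trotter): $\widetilde Y(t_i)=X_{i-1}(y+\mu\Delta)$. L2 (second Lie-Trotter): $\widetilde Y(t_i)=yX_{i-1}+\mu\Delta$. S1 (first Strang): $\widetilde Y(t_i)=(y+\mu\frac\Delta2)X_{i-1}+\mu\frac\Delta2$. S2 (second Strang):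 $\widetilde Y(t_i)=y\,e^{-a\Delta+\sigma(\varphi_{i-1}+\psi_{i-1})}+\mu\Delta\,e^{-a\Delta/2+\sigma\psi_{i-1}}$. Lin (piecewise linear): $\widetilde Y(t_i)=yX_{i-1}+\mu\Delta\,\alpha_{i-1}$. Log (log-ODE): $\widetilde Y(t_i)=yX_{i-1}+\mu\Delta\,\alpha_{i-1}\left(1-\sigma\rho_{i-1}+\sigma^2\left(\frac35\rho_{i-1}^2+\frac{\Delta}{30}\right)\right)$. With $\mathrm{erfi}(x)=\frac{2}{\sqrt\pi}\int_0^xe^{u^2}du$ the imaginary error function, $$L=\frac{\sqrt\pi}{\sigma\sqrt{2\Delta}}\exp\left(\frac{-(\frac1\tau+\frac{\sigma^2}2)^2\Delta}{2\sigma^2}\right)\left(\mathrm{erfi}\left[\frac{(\frac1\tau+\frac{\sigma^2}2)\sqrt\Delta}{\sigma\sqrt2}\right]+\mathrm{erfi}\left[\frac{(-\frac1\tau+\frac{\sigma^2}2)\sqrt\Delta}{\sigma\sqrt2}\right]\right),$$ $$\widetilde L=\frac{\sqrt\pi}{\sigma\sqrt{2\Delta}}\exp\left(\frac{-(\frac1\tau-\frac{\sigma^2}2)^2\Delta}{2\sigma^2}\right)\left(\mathrm{erfi}\left[\frac{(\frac1\tau-\frac{\sigma^2}2)\sqrt\Delta}{\sigma\sqrt2}\right]+\mathrm{erfi}\left[\frac{(-\frac1\tau+\frac{3\sigma^2}2)\sqrt\Delta}{\sigma\sqrt2}\right]\right),$$ $$\bar L=\frac{1}{2\sigma^3\Delta}\exp\left(\frac{-a^2\Delta}{2\sigma^2}\right)\Bigg\{-2\sigma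 e^{\frac{a\Delta}{2}\left[-4+\left(\frac1{\tau\sigma^2}+\frac12\right)\right]}\left(e^{2a\Delta}+e^{2\sigma^2\Delta}-2e^{a\Delta+\frac{\sigma^2}2\Delta}\right)$$ $$+\sqrt{2\pi\Delta}\left(\mathrm{erfi}\left[\frac{(\frac1\tau+\frac{\sigma^2}2)\sqrt\Delta}{\sigma\sqrt2}\right]a+\mathrm{erfi}\left[\frac{(\frac1\tau-\frac{3\sigma^2}2)\sqrt\Delta}{\sigma\sqrt2}\right](a-2\sigma^2)+\mathrm{erfi}\left[\frac{(\frac1\tau-\frac{\sigma^2}2)\sqrt\Delta}{\sigma\sqrt2}\right]2\left(-\frac1\tau+\frac{\sigma^2}2\right)\right)\Bigg\},$$ $$K=L\left(1+\frac{\sigma^2\Delta}{12}\right),\quad \bar K=\bar L\left(1+\frac{\sigma^2\Delta}{4}+\frac{43}{3600}\sigma^4\Delta^2\right),\quad \widetilde K=\widetilde L\left(1+\frac{\sigma^2\Delta}{12}\right).$$ Empty sums are $0$. *)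

theory Defs
  imports "HOL-Probability.Probability"
begin

(* The interval integral is oriented, so this is also right for negative x. *)
definition erfi :: "real \<Rightarrow> real" where
  "erfi x = 2 / sqrt pi * (LBINT u=0..x. exp (u\<^sup>2))"

definition cond_variance :: "'a measure \<Rightarrow> 'a measure \<Rightarrow> ('a \<Rightarrow> real) \<Rightarrow> 'a \<Rightarrow> real" where
  "cond_variance M F X = real_cond_exp M F (\<lambda>\<omega>. (X \<omega> - real_cond_exp M F X \<omega>)\<^sup>2)"

definition sigma_gen :: "'a measure \<Rightarrow> ('a \<Rightarrow> real) \<Rightarrow> 'a measure" where
  "sigma_gen M Z = vimage_algebra (space M) Z borel"

datatype scheme =
    Euler_Maruyama
  | Milstein
  | Lie_Trotter1
  | Lie_Trotter2
  | Strang1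
  | Strang2
  | Piecewise_Linear
  | Log_ODE

definition igbm_a :: "real \<Rightarrow> real \<Rightarrow> real" where
  "igbm_a \<tau> \<sigma> = 1 / \<tau> + \<sigma>\<^sup>2 / 2"

definition igbm_X :: "real \<Rightarrow> real \<Rightarrow> real \<Rightarrow> real \<Rightarrow> real" where
  "igbm_X \<tau> \<sigma> \<Delta> x = exp (- igbm_a \<tau> \<sigma> * \<Delta> + \<sigma> * x)"

(* The denominator vanishes for a single value of x only, a null event for a Gaussian x. *)
definition igbm_alpha :: "real \<Rightarrow> real \<Rightarrow> real \<Rightarrow> real \<Rightarrow> real" where
  "igbm_alpha \<tau> \<sigma> \<Delta> x =
     (exp (- igbm_a \<tau> \<sigma> * \<Delta> + \<sigma> * x) - 1) / (- igbm_a \<tau> \<sigma> * \<Delta> + \<sigma> * x)"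

(* One step from the value y; x, q, f, g are the current values of
   \<xi>, \<rho>, \<phi>, \<psi> respectively. *)
fun scheme_step :: "scheme \<Rightarrow> real \<Rightarrow> real \<Rightarrow> real \<Rightarrow> real \<Rightarrow>
    real \<Rightarrow> real \<Rightarrow> real \<Rightarrow> real \<Rightarrow> real \<Rightarrow> real" where
  "scheme_step Euler_Maruyama \<tau> \<sigma> \<mu> \<Delta> x q f g y =
     y + \<Delta> * (- (1 / \<tau>) * y + \<mu>) + \<sigma> * y * x"
| "scheme_step Milstein \<tau> \<sigma> \<mu> \<Delta> x q f g y =
     y + \<Delta> * (- (1 / \<tau>) * y + \<mu>) + \<sigma> * y * (x + \<sigma> / 2 * (x\<^sup>2 - \<Delta>))"
| "scheme_step Lie_Trotter1 \<tau> \<sigma> \<mu> \<Delta> x q f g y =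
     igbm_X \<tau> \<sigma> \<Delta> x * (y + \<mu> * \<Delta>)"
| "scheme_step Lie_Trotter2 \<tau> \<sigma> \<mu> \<Delta> x q f g y =
     y * igbm_X \<tau> \<sigma> \<Delta> x + \<mu> * \<Delta>"
| "scheme_step Strang1 \<tau> \<sigma> \<mu> \<Delta> x q f g y =
     (y + \<mu> * (\<Delta> / 2)) * igbm_X \<tau> \<sigma> \<Delta> x + \<mu> * (\<Delta> / 2)"
| "scheme_step Strang2 \<tau> \<sigma> \<mu> \<Delta> x q f g y =
     y * exp (- igbm_a \<tau> \<sigma> * \<Delta> + \<sigma> * (f + g))
       + \<mu> * \<Delta> * exp (- igbm_a \<tau> \<sigma> * \<Delta> / 2 + \<sigma> * g)"
| "scheme_step Piecewise_Linear \<tau> \<sigma> \<mu> \<Delta> x q f g y =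
     y * igbm_X \<tau> \<sigma> \<Delta> x + \<mu> * \<Delta> * igbm_alpha \<tau> \<sigma> \<Delta> x"
| "scheme_step Log_ODE \<tau> \<sigma> \<mu> \<Delta> x q f g y =
     y * igbm_X \<tau> \<sigma> \<Delta> x
       + \<mu> * \<Delta> * igbm_alpha \<tau> \<sigma> \<Delta> x * (1 - \<sigma> * q + \<sigma>\<^sup>2 * (3 / 5 * q\<^sup>2 + \<Delta> / 30))"

primrec scheme_sol :: "scheme \<Rightarrow> real \<Rightarrow> real \<Rightarrow> real \<Rightarrow> real \<Rightarrow> ('a \<Rightarrow> real) \<Rightarrow>
    (nat \<Rightarrow> 'a \<Rightarrow> real) \<Rightarrow> (nat \<Rightarrow> 'a \<Rightarrow> real) \<Rightarrow> (nat \<Rightarrow> 'a \<Rightarrow> real) \<Rightarrow>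
    (nat \<Rightarrow> 'a \<Rightarrow> real) \<Rightarrow> nat \<Rightarrow> 'a \<Rightarrow> real" where
  "scheme_sol s \<tau> \<sigma> \<mu> \<Delta> Y0 \<xi> \<rho> \<phi> \<psi> 0 = Y0"
| "scheme_sol s \<tau> \<sigma> \<mu> \<Delta> Y0 \<xi> \<rho> \<phi> \<psi> (Suc i) =
     (\<lambda>\<omega>. scheme_step s \<tau> \<sigma> \<mu> \<Delta> (\<xi> i \<omega>) (\<rho> i \<omega>) (\<phi> i \<omega>) (\<psi> i \<omega>)
            (scheme_sol s \<tau> \<sigma> \<mu> \<Delta> Y0 \<xi> \<rho> \<phi> \<psi> i \<omega>))"

definition igbm_L :: "real \<Rightarrow> real \<Rightarrow> real \<Rightarrow> real" where
  "igbm_L \<tau> \<sigma> \<Delta> =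
     sqrt pi / (\<sigma> * sqrt (2 * \<Delta>))
     * exp (- ((1 / \<tau> + \<sigma>\<^sup>2 / 2)\<^sup>2 * \<Delta>) / (2 * \<sigma>\<^sup>2))
     * (erfi ((1 / \<tau> + \<sigma>\<^sup>2 / 2) * sqrt \<Delta> / (\<sigma> * sqrt 2))
        + erfi ((- (1 / \<tau>) + \<sigma>\<^sup>2 / 2) * sqrt \<Delta> / (\<sigma> * sqrt 2)))"

definition igbm_L_tilde :: "real \<Rightarrow> real \<Rightarrow> real \<Rightarrow> real" where
  "igbm_L_tilde \<tau> \<sigma> \<Delta> =
     sqrt pi / (\<sigma> * sqrt (2 * \<Delta>))
     * exp (- ((1 / \<tau> - \<sigma>\<^sup>2 / 2)\<^sup>2 * \<Delta>) / (2 * \<sigma>\<^sup>2))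
     * (erfi ((1 / \<tau> - \<sigma>\<^sup>2 / 2) * sqrt \<Delta> / (\<sigma> * sqrt 2))
        + erfi ((- (1 / \<tau>) + 3 * \<sigma>\<^sup>2 / 2) * sqrt \<Delta> / (\<sigma> * sqrt 2)))"

definition igbm_L_bar :: "real \<Rightarrow> real \<Rightarrow> real \<Rightarrow> real" where
  "igbm_L_bar \<tau> \<sigma> \<Delta> = (let a = igbm_a \<tau> \<sigma> in
     1 / (2 * \<sigma> ^ 3 * \<Delta>) * exp (- (a\<^sup>2 * \<Delta>) / (2 * \<sigma>\<^sup>2))
     * (- 2 * \<sigma> * exp (a * \<Delta> / 2 * (- 4 + (1 / (\<tau> * \<sigma>\<^sup>2) + 1 / 2)))
            * (exp (2 * a * \<Delta>) + exp (2 * \<sigma>\<^sup>2 * \<Delta>) - 2 * exp (a * \<Delta> + \<sigma>\<^sup>2 / 2 * \<Delta>))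
        + sqrt (2 * pi * \<Delta>)
          * (erfi ((1 / \<tau> + \<sigma>\<^sup>2 / 2) * sqrt \<Delta> / (\<sigma> * sqrt 2)) * a
             + erfi ((1 / \<tau> - 3 * \<sigma>\<^sup>2 / 2) * sqrt \<Delta> / (\<sigma> * sqrt 2)) * (a - 2 * \<sigma>\<^sup>2)
             + erfi ((1 / \<tau> - \<sigma>\<^sup>2 / 2) * sqrt \<Delta> / (\<sigma> * sqrt 2)) * 2 * (- (1 / \<tau>) + \<sigma>\<^sup>2 / 2))))"

definition igbm_K :: "real \<Rightarrow> real \<Rightarrow> real \<Rightarrow> real" where
  "igbm_K \<tau> \<sigma> \<Delta> = igbm_L \<tau> \<sigma> \<Delta> * (1 + \<sigma>\<^sup>2 * \<Delta> / 12)"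

definition igbm_K_bar :: "real \<Rightarrow> real \<Rightarrow> real \<Rightarrow> real" where
  "igbm_K_bar \<tau> \<sigma> \<Delta> =
     igbm_L_bar \<tau> \<sigma> \<Delta> * (1 + \<sigma>\<^sup>2 * \<Delta> / 4 + 43 / 3600 * \<sigma> ^ 4 * \<Delta>\<^sup>2)"

definition igbm_K_tilde :: "real \<Rightarrow> real \<Rightarrow> real \<Rightarrow> real" where
  "igbm_K_tilde \<tau> \<sigma> \<Delta> = igbm_L_tilde \<tau> \<sigma> \<Delta> * (1 + \<sigma>\<^sup>2 * \<Delta> / 12)"

definition coef_mu_x :: "scheme \<Rightarrow> real \<Rightarrow> real \<Rightarrow> real \<Rightarrow> real" where
  "coef_mu_x s \<tau> \<sigma> \<Delta> = (case s of
       Euler_Maruyama \<Rightarrow> 1 - \<Delta> / \<tau>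
     | Milstein \<Rightarrow> 1 - \<Delta> / \<tau>
     | _ \<Rightarrow> exp (- \<Delta> / \<tau>))"

definition coef_r :: "scheme \<Rightarrow> real \<Rightarrow> real \<Rightarrow> real \<Rightarrow> real" where
  "coef_r s \<tau> \<sigma> \<Delta> = (case s of
       Euler_Maruyama \<Rightarrow> \<sigma>\<^sup>2 * \<Delta> + (1 - \<Delta> / \<tau>)\<^sup>2
     | Milstein \<Rightarrow> \<sigma>\<^sup>2 * \<Delta> + (1 - \<Delta> / \<tau>)\<^sup>2 + (\<sigma>\<^sup>2 * \<Delta>)\<^sup>2 / 2
     | _ \<Rightarrow> exp (\<sigma>\<^sup>2 * \<Delta> - 2 * \<Delta> / \<tau>))"

definition coef_mu_h :: "scheme \<Rightarrow> real \<Rightarrow> real \<Rightarrow> real \<Rightarrow> real" where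
  "coef_mu_h s \<tau> \<sigma> \<Delta> = (case s of
       Strang2 \<Rightarrow> coef_mu_x s \<tau> \<sigma> \<Delta> powr (1 / 2)
     | Piecewise_Linear \<Rightarrow> igbm_L \<tau> \<sigma> \<Delta>
     | Log_ODE \<Rightarrow> igbm_K \<tau> \<sigma> \<Delta>
     | _ \<Rightarrow> 1)"

definition coef_r_h :: "scheme \<Rightarrow> real \<Rightarrow> real \<Rightarrow> real \<Rightarrow> real" where
  "coef_r_h s \<tau> \<sigma> \<Delta> = (case s of
       Strang2 \<Rightarrow> coef_r s \<tau> \<sigma> \<Delta> powr (1 / 2)
     | Piecewise_Linear \<Rightarrow> igbm_L_bar \<tau> \<sigma> \<Delta>
     | Log_ODE \<Rightarrow> igbm_K_bar \<tau> \<sigma> \<Delta>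
     | _ \<Rightarrow> 1)"

definition coef_p :: "scheme \<Rightarrow> real \<Rightarrow> real \<Rightarrow> real \<Rightarrow> real" where
  "coef_p s \<tau> \<sigma> \<Delta> = (case s of
       Strang2 \<Rightarrow> coef_r_h s \<tau> \<sigma> \<Delta> * coef_mu_x s \<tau> \<sigma> \<Delta> powr (- (1 / 2))
     | Piecewise_Linear \<Rightarrow> igbm_L_tilde \<tau> \<sigma> \<Delta>
     | Log_ODE \<Rightarrow> igbm_K_tilde \<tau> \<sigma> \<Delta>
     | _ \<Rightarrow> 1)"

definition coef_c2 :: "scheme \<Rightarrow> real \<Rightarrow> real \<Rightarrow> real" where
  "coef_c2 s \<mu> \<Delta> = (case s of
       Euler_Maruyama \<Rightarrow> \<mu> * \<Delta>
     | Milstein \<Rightarrow> \<mu> * \<Delta>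
     | Strang1 \<Rightarrow> \<mu> * \<Delta> / 2
     | _ \<Rightarrow> 0)"

definition coef_I :: "scheme \<Rightarrow> nat \<Rightarrow> nat" where
  "coef_I s i = (case s of Lie_Trotter1 \<Rightarrow> i | _ \<Rightarrow> i - 1)"

definition coef_Z0 :: "scheme \<Rightarrow> real \<Rightarrow> real \<Rightarrow> real \<Rightarrow> real" where
  "coef_Z0 s \<mu> \<Delta> y0 = (case s of Strang1 \<Rightarrow> y0 + \<mu> * \<Delta> / 2 | _ \<Rightarrow> y0)"

definition coef_W0 :: "scheme \<Rightarrow> real" where
  "coef_W0 s = (case s of
       Lie_Trotter2 \<Rightarrow> 1
     | Strang2 \<Rightarrow> 1
     | Piecewise_Linear \<Rightarrow> 1
     | Log_ODE \<Rightarrow> 1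
     | _ \<Rightarrow> 0)"

end

(* Every scheme except the first Lie-Trotter one satisfies, for Z = Y + b with a constant b, an affine
   recursion Z' = A Z + c1 H whose coefficient pairs (A, H) are iid functions of the noise (in the first
   Lie-Trotter scheme the same holds with b = 0 and H = A, which shifts the sums by one index).
   Hence Y(t_i) = P (Y0 + b) + c1 Q - b, where (P, Q) is a function of the noise, independent of Y0: given Y0,
   the mean and the variance are polynomials in Y0 with coefficients E P, E Q, Var P, Cov(P, Q), Var Q.
   These obey linear recursions in the step moments E A, E H, E A^2, E(A H) = p E A and E H^2, which sum to the
   stated closed forms. The step moments involving alpha = (e^z - 1) / z are found by writing alpha as
   an integral of e^(v z) over v in [0, 1] and exchanging it with the Gaussian expectation. *)

theory Submission
  imports Defs
begin

section \<open>Conditional moments given an independent variable\<close>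

text \<open>A and H of the same step are correlated, so E(A H) must be carried along; dividing it by
  E A gives p, the normalisation that fits the power \<open>\<mu>\<^sub>x ^ (i - k)\<close>. Only
  the first Strang scheme has b nonzero: adding \<mu> \<Delta> / 2 turns it into the recursion of
  the second Lie-Trotter scheme. The exponent of X has moment generating function exp(- a \<Delta> v
  + \<sigma>^2 \<Delta> v^2 / 2) at v. The coefficient of v^2 is positive, so completing the square
  leads to erfi and not to erf. L, L tilde (times \<open>\<mu>\<^sub>x\<close>) and L bar are
  integrals of this function over v with nonnegative weights, so Tonelli justifies the exchange. In
  the log-ODE scheme the factor beside \<alpha> depends on \<rho> alone, hence K, K tilde and K bar
  are the same integrals times a Gaussian polynomial moment. \<open>has_bochner_integral\<close> is
  used throughout because it keeps integrability and value together.\<close>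

lemma has_bochner_integral_indep_mult:
  fixes X Y :: "'a \<Rightarrow> real"
  assumes "prob_space M" "prob_space.indep_var M borel X borel Y"
    and "has_bochner_integral M X x" "has_bochner_integral M Y y"
  shows "has_bochner_integral M (\<lambda>\<omega>. X \<omega> * Y \<omega>) (x * y)"
proof -
  interpret prob_space M by fact
  have "integrable M X" "integrable M Y" "integral\<^sup>L M X = x" "integral\<^sup>L M Y = y"
    using assms(3,4) by (auto simp: has_bochner_integral_iff)
  then show ?thesis
    using indep_var_lebesgue_integral[OF assms(2)] indep_var_integrable[OF assms(2)]
    by (simp add: has_bochner_integral_iff)
qed

lemma subalgebra_sigma_gen:
  "Z \<in> borel_measurable M \<Longrightarrow> subalgebra M (sigma_gen M Z)"
  unfolding subalgebra_def sigma_gen_def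
  by (auto simp: sets_vimage_algebra2 measurable_sets)

lemma measurable_sigma_gen_comp:
  assumes "f \<in> borel_measurable borel"
  shows "(\<lambda>\<omega>. f (Z \<omega>)) \<in> borel_measurable (sigma_gen M Z)"
proof -
  have "Z \<in> measurable (sigma_gen M Z) borel"
    unfolding sigma_gen_def by (rule measurable_vimage_algebra1) auto
  with assms show ?thesis by (rule measurable_compose[rotated])
qed

text \<open>The constant \<open>indep_var\<close> needs both variables to have the same type, hence this detour through
  real-valued functions of them.\<close>

definition indep_of :: "'a measure \<Rightarrow> ('a \<Rightarrow> real) \<Rightarrow> 'b measure \<Rightarrow> ('a \<Rightarrow> 'b) \<Rightarrow> bool" where
  "indep_of M Z N V \<longleftrightarrow> Z \<in> borel_measurable M \<and> V \<in> measurable M N \<and>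
     (\<forall>f\<in>borel_measurable borel. \<forall>g\<in>borel_measurable N.
        prob_space.indep_var M borel (\<lambda>\<omega>. f (Z \<omega>) :: real) borel (\<lambda>\<omega>. g (V \<omega>) :: real))"

lemma indep_ofD:
  assumes "indep_of M Z N V"
  shows "Z \<in> borel_measurable M" "V \<in> measurable M N"
    and "f \<in> borel_measurable borel \<Longrightarrow> g \<in> borel_measurable N \<Longrightarrow>
      prob_space.indep_var M borel (\<lambda>\<omega>. f (Z \<omega>) :: real) borel (\<lambda>\<omega>. g (V \<omega>) :: real)"
  using assms by (auto simp: indep_of_def)

text \<open>A constant is measurable for every subalgebra, so only its integral over each event has
  to match. Such an event is the preimage of a Borel set B under Z, and independence of
  \<open>indicator B (Z \<omega>)\<close> and \<open>g (V \<omega>)\<close> splits the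
  integral.\<close>

lemma real_cond_exp_sigma_gen_indep:
  fixes Z :: "'a \<Rightarrow> real" and g :: "'b \<Rightarrow> real"
  assumes "prob_space M" and ind: "indep_of M Z N V"
    and g: "g \<in> borel_measurable N"
    and int: "has_bochner_integral M (\<lambda>\<omega>. g (V \<omega>)) c"
  shows "AE \<omega> in M. real_cond_exp M (sigma_gen M Z) (\<lambda>\<omega>. g (V \<omega>)) \<omega> = c"
proof -
  interpret prob_space M by fact
  have Z: "Z \<in> borel_measurable M" using indep_ofD(1)[OF ind] .
  have sub: "subalgebra M (sigma_gen M Z)" by (rule subalgebra_sigma_gen[OF Z])
  interpret F: finite_measure_subalgebra M "sigma_gen M Z"
    using sub by unfold_locales
  show ?thesis
  proof (rule F.real_cond_exp_charact)
    fix A assume A: "A \<in> sets (sigma_gen M Z)"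
    then obtain B where B: "B \<in> sets borel" "A = Z -` B \<inter> space M"
      unfolding sigma_gen_def by (auto simp: sets_vimage_algebra2)
    have ind': "indep_var borel (\<lambda>\<omega>. indicator B (Z \<omega>) :: real) borel (\<lambda>\<omega>. g (V \<omega>))"
      using B g by (intro indep_ofD(3)[OF ind]) auto
    have AM: "A \<in> sets M" using A sub by (auto simp: subalgebra_def)
    have eq: "indicator A \<omega> = (indicator B (Z \<omega>) :: real)" if "\<omega> \<in> space M" for \<omega>
      using that B by (auto simp: indicator_def)
    have "has_bochner_integral M (indicator A :: _ \<Rightarrow> real) (prob A)"
      using AM by (simp add: has_bochner_integral_iff emeasure_eq_measure)
    then have "has_bochner_integral M (\<lambda>\<omega>. indicator B (Z \<omega>) :: real) (prob A)"
      by (rule has_bochner_integral_cong[THEN iffD1, rotated -1]) (auto simp: eq)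
    from has_bochner_integral_indep_mult[OF \<open>prob_space M\<close> ind' this int]
    have "(\<integral>\<omega>. indicator B (Z \<omega>) * g (V \<omega>) \<partial>M) = prob A * c"
      by (rule has_bochner_integral_integral_eq)
    moreover have "(\<integral>\<omega>\<in>A. g (V \<omega>) \<partial>M) = (\<integral>\<omega>. indicator B (Z \<omega>) * g (V \<omega>) \<partial>M)"
      unfolding set_lebesgue_integral_def by (intro Bochner_Integration.integral_cong) (auto simp: eq)
    ultimately show "(\<integral>\<omega>\<in>A. g (V \<omega>) \<partial>M) = (\<integral>\<omega>\<in>A. c \<partial>M)"
      using AM by (simp add: set_lebesgue_integral_def)
  qed (use int in \<open>auto simp: has_bochner_integral_iff\<close>)
qed

text \<open>The recursions yield raw moments; expanding the centred products turns them into
  variances and a covariance, constants integrating to themselves on a probability space.\<close>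

lemma has_bochner_integral_affine_moments:
  fixes p q :: "'a \<Rightarrow> real"
  assumes "prob_space M"
    and "has_bochner_integral M (\<lambda>\<omega>. p \<omega>) mp" "has_bochner_integral M (\<lambda>\<omega>. q \<omega>) mq"
    and "has_bochner_integral M (\<lambda>\<omega>. (p \<omega>)\<^sup>2) mpp"
    and "has_bochner_integral M (\<lambda>\<omega>. p \<omega> * q \<omega>) mpq"
    and "has_bochner_integral M (\<lambda>\<omega>. (q \<omega>)\<^sup>2) mqq"
  shows "has_bochner_integral M (\<lambda>\<omega>. (p \<omega> - mp)\<^sup>2) (mpp - mp\<^sup>2)"
    and "has_bochner_integral M (\<lambda>\<omega>. (p \<omega> - mp) * (q \<omega> - mq)) (mpq - mp * mq)"
    and "has_bochner_integral M (\<lambda>\<omega>. (q \<omega> - mq)\<^sup>2) (mqq - mq\<^sup>2)"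
proof -
  interpret prob_space M by fact
  have one: "has_bochner_integral M (\<lambda>\<omega>. c) c" for c :: real
    by (simp add: has_bochner_integral_iff prob_space)
  have "has_bochner_integral M (\<lambda>\<omega>. (p \<omega>)\<^sup>2 - 2 * mp * p \<omega> + mp\<^sup>2) (mpp - 2 * mp * mp + mp\<^sup>2)"
    by (intro has_bochner_integral_add has_bochner_integral_diff has_bochner_integral_mult_right assms one)
  then show "has_bochner_integral M (\<lambda>\<omega>. (p \<omega> - mp)\<^sup>2) (mpp - mp\<^sup>2)"
    by (simp add: power2_eq_square algebra_simps)
  have "has_bochner_integral M (\<lambda>\<omega>. (q \<omega>)\<^sup>2 - 2 * mq * q \<omega> + mq\<^sup>2) (mqq - 2 * mq * mq + mq\<^sup>2)"
    by (intro has_bochner_integral_add has_bochner_integral_diff has_bochner_integral_mult_right assms one)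
  then show "has_bochner_integral M (\<lambda>\<omega>. (q \<omega> - mq)\<^sup>2) (mqq - mq\<^sup>2)"
    by (simp add: power2_eq_square algebra_simps)
  have "has_bochner_integral M (\<lambda>\<omega>. p \<omega> * q \<omega> - mq * p \<omega> - mp * q \<omega> + mp * mq)
      (mpq - mq * mp - mp * mq + mp * mq)"
    by (intro has_bochner_integral_add has_bochner_integral_diff has_bochner_integral_mult_right assms one)
  then show "has_bochner_integral M (\<lambda>\<omega>. (p \<omega> - mp) * (q \<omega> - mq)) (mpq - mp * mq)"
    by (simp add: algebra_simps)
qed

text \<open>\<open>f (Z \<omega>)\<close> is measurable for the conditioning algebra and can be
  pulled out. Integrability of the product comes from independence, so \<open>f (Z \<omega>)\<close>
  needs a first moment only; for quadratic f this is a second moment of Z.\<close>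

lemma real_cond_exp_factor_indep:
  fixes Z :: "'a \<Rightarrow> real" and g :: "'b \<Rightarrow> real"
  assumes "prob_space M" and ind: "indep_of M Z N V"
    and g: "g \<in> borel_measurable N" and f: "f \<in> borel_measurable borel"
    and intf: "integrable M (\<lambda>\<omega>. f (Z \<omega>))"
    and int: "has_bochner_integral M (\<lambda>\<omega>. g (V \<omega>)) c"
  shows "integrable M (\<lambda>\<omega>. f (Z \<omega>) * g (V \<omega>))"
    and "AE \<omega> in M. real_cond_exp M (sigma_gen M Z) (\<lambda>\<omega>. f (Z \<omega>) * g (V \<omega>)) \<omega> = f (Z \<omega>) * c"
proof -
  interpret prob_space M by fact
  have Z: "Z \<in> borel_measurable M" using indep_ofD(1)[OF ind] .
  interpret F: finite_measure_subalgebra M "sigma_gen M Z"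
    using subalgebra_sigma_gen[OF Z] by unfold_locales
  have "indep_var borel (\<lambda>\<omega>. f (Z \<omega>)) borel (\<lambda>\<omega>. g (V \<omega>))"
    by (rule indep_ofD(3)[OF ind f g])
  then show fg: "integrable M (\<lambda>\<omega>. f (Z \<omega>) * g (V \<omega>))"
    using indep_var_integrable intf int by (auto simp: has_bochner_integral_iff)
  have gm: "(\<lambda>\<omega>. g (V \<omega>)) \<in> borel_measurable M"
    using int by (auto simp: has_bochner_integral_iff)
  show "AE \<omega> in M. real_cond_exp M (sigma_gen M Z) (\<lambda>\<omega>. f (Z \<omega>) * g (V \<omega>)) \<omega> = f (Z \<omega>) * c"
    using F.real_cond_exp_mult[OF measurable_sigma_gen_comp[OF f] gm fg]
      real_cond_exp_sigma_gen_indep[OF \<open>prob_space M\<close> ind g int]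
    by eventually_elim simp
qed

lemma real_cond_exp_affine:
  fixes Z Y :: "'a \<Rightarrow> real" and p q :: "'b \<Rightarrow> real"
  assumes ps: "prob_space M" and ind: "indep_of M Z N V"
    and p: "p \<in> borel_measurable N" and q: "q \<in> borel_measurable N"
    and Z2: "integrable M (\<lambda>\<omega>. (Z \<omega>)\<^sup>2)"
    and mp: "has_bochner_integral M (\<lambda>\<omega>. p (V \<omega>)) mp" and mq: "has_bochner_integral M (\<lambda>\<omega>. q (V \<omega>)) mq"
    and Y: "\<And>\<omega>. Y \<omega> = p (V \<omega>) * (Z \<omega> + b) + q (V \<omega>) + d"
  shows "AE \<omega> in M. real_cond_exp M (sigma_gen M Z) Y \<omega> = (Z \<omega> + b) * mp + mq + d"
proof -
  interpret prob_space M by fact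
  have Z: "Z \<in> borel_measurable M" using indep_ofD(1)[OF ind] .
  interpret F: finite_measure_subalgebra M "sigma_gen M Z"
    using subalgebra_sigma_gen[OF Z] by unfold_locales
  have iZ: "integrable M (\<lambda>\<omega>. Z \<omega> + b)"
    using square_integrable_imp_integrable[OF Z Z2] by simp
  have f: "(\<lambda>z. z + b) \<in> borel_measurable borel" by measurable
  note pZ = real_cond_exp_factor_indep[OF ps ind p f iZ mp]
  have qd: "has_bochner_integral M (\<lambda>\<omega>. q (V \<omega>) + d) (mq + d)"
    using has_bochner_integral_add[OF mq, of "\<lambda>_. d" d]
    by (simp add: has_bochner_integral_iff prob_space)
  have qm: "(\<lambda>v. q v + d) \<in> borel_measurable N" using q by measurable
  have iq: "integrable M (\<lambda>\<omega>. q (V \<omega>) + d)" using qd by (simp add: has_bochner_integral_iff)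
  have "Y = (\<lambda>\<omega>. (Z \<omega> + b) * p (V \<omega>) + (q (V \<omega>) + d))"
    by (auto simp: Y)
  then show ?thesis
    using F.real_cond_exp_add[OF pZ(1) iq] pZ(2) real_cond_exp_sigma_gen_indep[OF ps ind qm qd]
    by (elim AE_mp) (auto intro!: AE_I2)
qed

text \<open>Almost everywhere Y minus its conditional mean is (p - mp)(Z + b) + (q - mq), the
  constant d having cancelled. The square is a sum of three products of a function of Z and a
  function of V, and the means of the latter are Var p, Cov(p, q) and Var q.\<close>

lemma cond_variance_affine:
  fixes Z Y :: "'a \<Rightarrow> real" and p q :: "'b \<Rightarrow> real"
  assumes ps: "prob_space M" and ind: "indep_of M Z N V"
    and p: "p \<in> borel_measurable N" and q: "q \<in> borel_measurable N"
    and Z2: "integrable M (\<lambda>\<omega>. (Z \<omega>)\<^sup>2)"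
    and mp: "has_bochner_integral M (\<lambda>\<omega>. p (V \<omega>)) mp" and mq: "has_bochner_integral M (\<lambda>\<omega>. q (V \<omega>)) mq"
    and "has_bochner_integral M (\<lambda>\<omega>. (p (V \<omega>))\<^sup>2) mpp"
    and "has_bochner_integral M (\<lambda>\<omega>. p (V \<omega>) * q (V \<omega>)) mpq"
    and "has_bochner_integral M (\<lambda>\<omega>. (q (V \<omega>))\<^sup>2) mqq"
    and Y: "\<And>\<omega>. Y \<omega> = p (V \<omega>) * (Z \<omega> + b) + q (V \<omega>) + d"
  shows "AE \<omega> in M. cond_variance M (sigma_gen M Z) Y \<omega> =
    (Z \<omega> + b)\<^sup>2 * (mpp - mp\<^sup>2) + 2 * (Z \<omega> + b) * (mpq - mp * mq) + (mqq - mq\<^sup>2)"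
proof -
  interpret prob_space M by fact
  have Z: "Z \<in> borel_measurable M" using indep_ofD(1)[OF ind] .
  interpret F: finite_measure_subalgebra M "sigma_gen M Z"
    using subalgebra_sigma_gen[OF Z] by unfold_locales
  note mom = has_bochner_integral_affine_moments[where p = "\<lambda>\<omega>. p (V \<omega>)" and q = "\<lambda>\<omega>. q (V \<omega>)", OF ps mp mq assms(8-10)]
  define f1 where "f1 z = (z + b)\<^sup>2" for z :: real
  define f2 where "f2 z = 2 * (z + b)" for z :: real
  define g1 where "g1 v = (p v - mp)\<^sup>2" for v
  define g2 where "g2 v = (p v - mp) * (q v - mq)" for v
  define g3 where "g3 v = (q v - mq)\<^sup>2" for v
  have [measurable]: "f1 \<in> borel_measurable borel" "f2 \<in> borel_measurable borel"
    unfolding f1_def f2_def by measurable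
  have g [measurable]: "g1 \<in> borel_measurable N" "g2 \<in> borel_measurable N" "g3 \<in> borel_measurable N"
    unfolding g1_def g2_def g3_def using p q by measurable
  have VN [measurable]: "V \<in> measurable M N" using indep_ofD(2)[OF ind] .
  have iZ: "integrable M Z" by (rule square_integrable_imp_integrable[OF Z Z2])
  have if1: "integrable M (\<lambda>\<omega>. f1 (Z \<omega>))"
  proof -
    have "integrable M (\<lambda>\<omega>. (Z \<omega>)\<^sup>2 + 2 * b * Z \<omega> + b\<^sup>2)" using Z2 iZ by simp
    then show ?thesis by (simp add: f1_def power2_sum algebra_simps)
  qed
  have if2: "integrable M (\<lambda>\<omega>. f2 (Z \<omega>))" using iZ by (simp add: f2_def)
  note t1 = real_cond_exp_factor_indep[OF ps ind g(1) _ if1 mom(1)[folded g1_def]]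
  note t2 = real_cond_exp_factor_indep[OF ps ind g(2) _ if2 mom(2)[folded g2_def]]
  note t3 = real_cond_exp_sigma_gen_indep[OF ps ind g(3) mom(3)[folded g3_def]]
  have i3: "integrable M (\<lambda>\<omega>. g3 (V \<omega>))"
    using mom(3) by (simp add: g3_def has_bochner_integral_iff)
  let ?W = "\<lambda>\<omega>. (f1 (Z \<omega>) * g1 (V \<omega>) + f2 (Z \<omega>) * g2 (V \<omega>)) + g3 (V \<omega>)"
  let ?C = "real_cond_exp M (sigma_gen M Z)"
  have [measurable]: "Z \<in> borel_measurable M" by (rule Z)
  have Ym: "Y \<in> borel_measurable M"
  proof -
    have "(\<lambda>\<omega>. p (V \<omega>) * (Z \<omega> + b) + q (V \<omega>) + d) \<in> borel_measurable M"
      using p q by measurable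
    then show ?thesis by (simp add: Y[abs_def])
  qed
  have i1: "integrable M (\<lambda>\<omega>. f1 (Z \<omega>) * g1 (V \<omega>))" and i2: "integrable M (\<lambda>\<omega>. f2 (Z \<omega>) * g2 (V \<omega>))"
    using t1(1) t2(1) by measurable
  \<comment> \<open>The inner conditional mean is known only almost everywhere; that is enough
    because the outer conditional expectation respects almost everywhere equality.\<close>
  have "AE \<omega> in M. (Y \<omega> - ?C Y \<omega>)\<^sup>2 = ?W \<omega>"
    using real_cond_exp_affine[OF ps ind p q Z2 mp mq Y]
  proof eventually_elim
    case (elim \<omega>)
    show ?case unfolding elim Y f1_def f2_def g1_def g2_def g3_def
      by (simp add: power2_eq_square algebra_simps)
  qed
  then have "AE \<omega> in M. ?C (\<lambda>\<omega>. (Y \<omega> - ?C Y \<omega>)\<^sup>2) \<omega> = ?C ?W \<omega>"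
  proof (rule F.real_cond_exp_cong)
    show "(\<lambda>\<omega>. (Y \<omega> - ?C Y \<omega>)\<^sup>2) \<in> borel_measurable M" using Ym by measurable
    show "?W \<in> borel_measurable M" using i1 i2 i3 by (auto intro!: borel_measurable_add borel_measurable_integrable)
  qed
  moreover have "AE \<omega> in M. ?C ?W \<omega> = ?C (\<lambda>\<omega>. f1 (Z \<omega>) * g1 (V \<omega>) + f2 (Z \<omega>) * g2 (V \<omega>)) \<omega> + ?C (\<lambda>\<omega>. g3 (V \<omega>)) \<omega>"
    by (rule F.real_cond_exp_add[OF Bochner_Integration.integrable_add[OF i1 i2] i3])
  moreover have "AE \<omega> in M. ?C (\<lambda>\<omega>. f1 (Z \<omega>) * g1 (V \<omega>) + f2 (Z \<omega>) * g2 (V \<omega>)) \<omega> =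
      ?C (\<lambda>\<omega>. f1 (Z \<omega>) * g1 (V \<omega>)) \<omega> + ?C (\<lambda>\<omega>. f2 (Z \<omega>) * g2 (V \<omega>)) \<omega>"
    by (rule F.real_cond_exp_add[OF i1 i2])
  moreover have "AE \<omega> in M. ?C (\<lambda>\<omega>. f1 (Z \<omega>) * g1 (V \<omega>)) \<omega> = f1 (Z \<omega>) * (mpp - mp\<^sup>2)"
    by (rule t1(2)) measurable
  moreover have "AE \<omega> in M. ?C (\<lambda>\<omega>. f2 (Z \<omega>) * g2 (V \<omega>)) \<omega> = f2 (Z \<omega>) * (mpq - mp * mq)"
    by (rule t2(2)) measurable
  ultimately show ?thesis
    using t3 unfolding cond_variance_def
    by eventually_elim (simp add: f1_def f2_def)
qed

section \<open>Closed forms of the moment recursions\<close>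

text \<open>For \<open>P' = A P\<close>, \<open>Q' = A Q + H\<close>, \<open>P = 1\<close>, \<open>Q = 0\<close> initially, the next three definitions are
  \<open>E Q\<close>, \<open>E (P Q)\<close> and \<open>E Q\<^sup>2\<close> after \<open>n\<close> steps, where \<open>m = E A\<close>, \<open>h = E H\<close>, \<open>r = E A\<^sup>2\<close>, \<open>m * p = E (A H)\<close>
  and \<open>s = E H\<^sup>2\<close>.\<close>

definition affine_mean :: "real \<Rightarrow> real \<Rightarrow> nat \<Rightarrow> real" where
  "affine_mean m h n = h * (\<Sum>k<n. m ^ k)"

definition affine_cross :: "real \<Rightarrow> real \<Rightarrow> real \<Rightarrow> nat \<Rightarrow> real" where
  "affine_cross m r p n = (\<Sum>k<n. r ^ k * m ^ (n - k) * p)"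

definition affine_square :: "real \<Rightarrow> real \<Rightarrow> real \<Rightarrow> real \<Rightarrow> real \<Rightarrow> nat \<Rightarrow> real" where
  "affine_square m h r p s n =
     (\<Sum>k<n. r ^ k * s) + 2 * (\<Sum>l<n. \<Sum>k<l. h * r ^ k * m ^ (l - k) * p)"

lemma affine_mean_Suc: "affine_mean m h (Suc n) = m * affine_mean m h n + h"
  unfolding affine_mean_def sum.lessThan_Suc_shift
  by (simp add: sum_distrib_left algebra_simps)

lemma affine_cross_Suc: "affine_cross m r p (Suc n) = r * affine_cross m r p n + m * p * m ^ n"
  unfolding affine_cross_def sum.lessThan_Suc_shift
  by (simp add: sum_distrib_left algebra_simps)

text \<open>The double sum grows by its last row l = n, which is h times
  \<open>affine_cross m r p n\<close>, whereas one step of the process multiplies everything by r.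
  Induction reconciles the two: the term m p m^n in the recursion of \<open>affine_cross\<close> is
  what extends \<open>affine_mean\<close> by one summand.\<close>

lemma affine_square_Suc:
  "affine_square m h r p s (Suc n) =
     r * affine_square m h r p s n + 2 * (m * p) * affine_mean m h n + s"
proof (induction n)
  case 0
  show ?case by (simp add: affine_square_def affine_mean_def)
next
  case (Suc n)
  have sq: "affine_square m h r p s (Suc n) =
      affine_square m h r p s n + r ^ n * s + 2 * h * affine_cross m r p n" for n
    unfolding affine_square_def affine_cross_def by (simp add: sum_distrib_left algebra_simps)
  have mn: "affine_mean m h (Suc n) = affine_mean m h n + h * m ^ n" for n
    by (simp add: affine_mean_def algebra_simps)
  have "affine_square m h r p s (Suc (Suc n)) =
      (r * affine_square m h r p s n + 2 * (m * p) * affine_mean m h n + s)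
      + r * (r ^ n * s) + 2 * h * (r * affine_cross m r p n + m * p * m ^ n)"
    unfolding sq[of "Suc n"] Suc.IH affine_cross_Suc by simp
  also have "\<dots> = r * (affine_square m h r p s n + r ^ n * s + 2 * h * affine_cross m r p n)
      + 2 * (m * p) * (affine_mean m h n + h * m ^ n) + s"
    by (simp add: algebra_simps)
  finally show ?case unfolding sq[of n, symmetric] mn[of n, symmetric] .
qed

text \<open>Diagonal plus twice the part below it: the same shape as \<open>affine_square\<close>,
  so that the two can be subtracted term by term.\<close>

lemma affine_mean_square:
  "(affine_mean m h n)\<^sup>2 =
     (\<Sum>k<n. m ^ (2 * k) * h\<^sup>2) + 2 * (\<Sum>l<n. \<Sum>k<l. m ^ (l + k) * h\<^sup>2)"
proof (induction n)
  case 0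
  show ?case by (simp add: affine_mean_def)
next
  case (Suc n)
  have "affine_mean m h (Suc n) = affine_mean m h n + h * m ^ n"
    by (simp add: affine_mean_def distrib_left)
  then have "(affine_mean m h (Suc n))\<^sup>2 =
      (affine_mean m h n)\<^sup>2 + m ^ (2 * n) * h\<^sup>2 + 2 * ((h * m ^ n) * affine_mean m h n)"
    by (simp only: power2_sum power_mult_distrib power_mult[symmetric] mult_ac)
  moreover have "(h * m ^ n) * affine_mean m h n = (\<Sum>k<n. m ^ (n + k) * h\<^sup>2)"
    by (simp only: affine_mean_def sum_distrib_left power_add power2_eq_square mult_ac)
  ultimately show ?case using Suc.IH by (simp add: distrib_left)
qed

lemma affine_covariance_sum:
  "affine_cross m r p n - m ^ n * affine_mean m h n =
     (\<Sum>k<n. r ^ k * m ^ (n - k) * p - m ^ (n + k) * h)"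
  by (simp add: affine_cross_def affine_mean_def sum_subtractf sum_distrib_left power_add algebra_simps)

lemma affine_variance_sum:
  "affine_square m h r p s n - (affine_mean m h n)\<^sup>2 =
     (\<Sum>k<n. r ^ k * s - m ^ (2 * k) * h\<^sup>2)
     + 2 * (\<Sum>l<n. \<Sum>k<l. h * r ^ k * m ^ (l - k) * p - m ^ (l + k) * h\<^sup>2)"
  unfolding affine_mean_square by (simp add: affine_square_def sum_subtractf)

section \<open>Passage to the index ranges of the stated formulas\<close>

lemma sum_atMost_pred:
  fixes f :: "nat \<Rightarrow> 'b :: comm_monoid_add"
  assumes "n \<ge> 1"
  shows "(\<Sum>k = 0..n - 1. f k) = (\<Sum>k<n. f k)"
  using assms by (intro sum.cong) auto

lemma sum_from_one_pred:
  fixes f :: "nat \<Rightarrow> 'b :: ab_group_add"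
  assumes "n \<ge> 1"
  shows "(\<Sum>k = 1..n - 1. f k) = (\<Sum>k<n. f k) - f 0"
proof -
  obtain j where n: "n = Suc j" using assms by (cases n) auto
  show ?thesis unfolding n sum.lessThan_Suc_shift
    by (simp add: sum.atLeast1_atMost_eq)
qed

text \<open>The summand of index 0 is split off because the stated mean does not keep it in the sum:
  it reappears there through W0 or through c2, depending on the scheme.\<close>

lemma affine_mean_closed:
  assumes "n \<ge> 1"
  shows "affine_mean m h n = h * (\<Sum>k = 1..n - 1. m ^ k) + h"
  unfolding sum_from_one_pred[OF assms] affine_mean_def by (simp add: algebra_simps)

lemma affine_covariance_closed:
  assumes "n \<ge> 1"
  shows "affine_cross m r p n - m ^ n * affine_mean m h n =
     (\<Sum>k = 0..n - 1. r ^ k * m ^ (n - k) * p - m ^ (n + k) * h)"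
  unfolding affine_covariance_sum sum_atMost_pred[OF assms] ..

lemma affine_variance_closed:
  assumes "n \<ge> 1"
  shows "affine_square m h r p s n - (affine_mean m h n)\<^sup>2 =
     (\<Sum>k = 0..n - 1. r ^ k * s - m ^ (2 * k) * h\<^sup>2)
     + 2 * (\<Sum>l = 1..n - 1. \<Sum>k = 0..l - 1. h * r ^ k * m ^ (l - k) * p - m ^ (l + k) * h\<^sup>2)"
proof -
  \<comment> \<open>For l >= 1 the range 0..l - 1 is the same as k < l; at l = 0 truncated
    subtraction would admit k = 0. So the inner range is rewritten while l starts at 1, and the row
    l = 0, now empty, is added afterwards.\<close>
  have "(\<Sum>l = 1..n - 1. \<Sum>k = 0..l - 1. h * r ^ k * m ^ (l - k) * p - m ^ (l + k) * h\<^sup>2) =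
      (\<Sum>l = 1..n - 1. \<Sum>k<l. h * r ^ k * m ^ (l - k) * p - m ^ (l + k) * h\<^sup>2)"
    by (intro sum.cong refl sum_atMost_pred) auto
  also have "\<dots> = (\<Sum>l<n. \<Sum>k<l. h * r ^ k * m ^ (l - k) * p - m ^ (l + k) * h\<^sup>2)"
    unfolding sum_from_one_pred[OF assms] by simp
  finally show ?thesis
    unfolding affine_variance_sum sum_atMost_pred[OF assms] by simp
qed

text \<open>The case \<open>H = A\<close> of the first Lie-Trotter scheme: here \<open>p = r / m\<close>, and moving a factor
  into the powers shifts all indices by one (the added terms with index 0 vanish).\<close>

lemma affine_mean_shift: "affine_mean m m n = (\<Sum>k = 1..n. m ^ k)"
  by (simp add: affine_mean_def sum_distrib_left sum.atLeast1_atMost_eq)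

lemma affine_covariance_shift:
  assumes "m \<noteq> 0"
  shows "affine_cross m r (r / m) n - m ^ n * affine_mean m m n =
     (\<Sum>k = 0..n. r ^ k * m ^ (n - k) - m ^ (n + k))"
proof -
  have "r ^ k * m ^ (n - k) * (r / m) - m ^ (n + k) * m =
      r ^ Suc k * m ^ (n - Suc k) - m ^ (n + Suc k)" if "k < n" for k
  proof -
    \<comment> \<open>Since k < n, the power contains a factor m that cancels the denominator of r /
      m.\<close>
    have "m ^ (n - k) = m * m ^ (n - Suc k)" using that by (metis Suc_diff_Suc power_Suc)
    then show ?thesis using assms by (simp add: field_simps)
  qed
  then show ?thesis
    unfolding affine_covariance_sum atLeast0AtMost sum.atMost_shift
    by (simp del: power_Suc)
qed

lemma affine_variance_shift:
  assumes "m \<noteq> 0"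
  shows "affine_square m m r (r / m) r n - (affine_mean m m n)\<^sup>2 =
     (\<Sum>k = 0..n. r ^ k - m ^ (2 * k))
     + 2 * (\<Sum>l = 1..n. \<Sum>k = 0..l - 1. r ^ k * m ^ (l - k) - m ^ (l + k))"
proof -
  \<comment> \<open>Row l turns into row Suc l with k raised by one; the extra summand k = 0 is a
    power of m minus itself.\<close>
  have eq: "(\<Sum>k = 0..Suc l - 1. r ^ k * m ^ (Suc l - k) - m ^ (Suc l + k)) =
      (\<Sum>k<l. m * r ^ k * m ^ (l - k) * (r / m) - m ^ (l + k) * m\<^sup>2)" for l
  proof -
    have "r ^ Suc k * m ^ (Suc l - Suc k) - m ^ (Suc l + Suc k) =
        m * r ^ k * m ^ (l - k) * (r / m) - m ^ (l + k) * m\<^sup>2" for k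
      using assms by (simp add: power2_eq_square)
    then show ?thesis
      unfolding atLeast0AtMost diff_Suc_1 sum.atMost_shift by (simp del: power_Suc diff_Suc_Suc)
  qed
  have "(\<Sum>l = 1..n. \<Sum>k = 0..l - 1. r ^ k * m ^ (l - k) - m ^ (l + k)) =
      (\<Sum>l<n. \<Sum>k<l. m * r ^ k * m ^ (l - k) * (r / m) - m ^ (l + k) * m\<^sup>2)"
    unfolding One_nat_def sum.atLeast1_atMost_eq eq[unfolded One_nat_def] ..
  moreover have "(\<Sum>k<n. r ^ k * r - m ^ (2 * k) * m\<^sup>2) = (\<Sum>k = 0..n. r ^ k - m ^ (2 * k))"
    unfolding atLeast0AtMost sum.atMost_shift
    by (simp add: power2_eq_square algebra_simps)
  ultimately show ?thesis unfolding affine_variance_sum by simp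
qed

section \<open>Gaussian moments\<close>

lemma distributed_has_bochner_integral:
  fixes f g :: "real \<Rightarrow> real"
  assumes "distributed M lborel X f" "\<And>x. 0 \<le> f x" "g \<in> borel_measurable borel"
    and "has_bochner_integral lborel (\<lambda>x. f x * g x) c"
  shows "has_bochner_integral M (\<lambda>\<omega>. g (X \<omega>)) c"
proof -
  have g: "g \<in> borel_measurable lborel" using assms(3) by simp
  show ?thesis
    using distributed_integrable[OF assms(1) g] distributed_integral[OF assms(1) g] assms(2,4)
    by (simp add: has_bochner_integral_iff)
qed

text \<open>Exponential tilting: by completing the square, the factor exp(c + t x) moves the mean of
  the density from 0 to s^2 t and leaves a constant.\<close>

lemma has_bochner_integral_normal_exp:
  assumes "s > 0"
  shows "has_bochner_integral lborel (\<lambda>x. normal_density 0 s x * exp (c + t * x)) (exp (c + s\<^sup>2 * t\<^sup>2 / 2))"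
proof -
  have "- (x\<^sup>2 / (2 * s\<^sup>2)) + (c + t * x) = c + s\<^sup>2 * t\<^sup>2 / 2 + - ((x - s\<^sup>2 * t)\<^sup>2 / (2 * s\<^sup>2))" for x
    using assms by (simp add: field_simps power2_eq_square)
  then have "normal_density 0 s x * exp (c + t * x) = exp (c + s\<^sup>2 * t\<^sup>2 / 2) * normal_density (s\<^sup>2 * t) s x" for x
    by (simp add: normal_density_def exp_add[symmetric])
  moreover have "has_bochner_integral lborel (normal_density (s\<^sup>2 * t) s) 1"
    using assms by (simp add: has_bochner_integral_iff integrable_normal_density integral_normal_density)
  then have "has_bochner_integral lborel (\<lambda>x. exp (c + s\<^sup>2 * t\<^sup>2 / 2) * normal_density (s\<^sup>2 * t) s x)
      (exp (c + s\<^sup>2 * t\<^sup>2 / 2) * 1)"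
    by (rule has_bochner_integral_mult_right)
  ultimately show ?thesis by simp
qed

text \<open>Tonelli for the product of the density, w(v) and exp(v (c + t x)): integrating over v
  first gives G, integrating over x first gives the moment generating function at v. As w is
  nonnegative, the computation runs in \<open>ennreal\<close> and delivers integrability with the
  value. \<open>GI\<close> holds almost everywhere only, because division by zero gives
  \<open>igbm_alpha\<close> the value 0 where its denominator vanishes, while the integral over
  [0, 1] is 1 there.\<close>

lemma has_bochner_integral_normal_exp_mixture:
  fixes w G :: "real \<Rightarrow> real"
  assumes s: "s > 0" and w [measurable]: "w \<in> borel_measurable borel" and w0: "\<And>v. w v \<ge> 0"
    and G [measurable]: "G \<in> borel_measurable borel"
    and GI: "AE x in lborel. has_bochner_integral lborel (\<lambda>v. w v * exp (v * (c + t * x))) (G x)"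
    and m: "has_bochner_integral lborel (\<lambda>v. w v * exp (v * c + s\<^sup>2 * (v * t)\<^sup>2 / 2)) m"
  shows "has_bochner_integral lborel (\<lambda>x. normal_density 0 s x * G x) m"
proof (rule has_bochner_integral_nn_integral)
  let ?N = "normal_density 0 s"
  have eqG: "AE x in lborel. G x \<ge> 0 \<and>
      ennreal (?N x * G x) = (\<integral>\<^sup>+v. ennreal (w v * (?N x * exp (v * c + v * t * x))) \<partial>lborel)"
    using GI
  proof eventually_elim
    case (elim x)
    then have int: "integrable lborel (\<lambda>v. w v * exp (v * (c + t * x)))"
      and val: "(\<integral>v. w v * exp (v * (c + t * x)) \<partial>lborel) = G x"
      by (auto simp: has_bochner_integral_iff)
    have "(\<integral>\<^sup>+v. ennreal (w v * (?N x * exp (v * c + v * t * x))) \<partial>lborel) =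
        (\<integral>\<^sup>+v. ennreal (?N x) * ennreal (w v * exp (v * (c + t * x))) \<partial>lborel)"
      by (intro nn_integral_cong) (simp add: ennreal_mult[symmetric] w0 algebra_simps)
    also have "\<dots> = ennreal (?N x) * (\<integral>\<^sup>+v. ennreal (w v * exp (v * (c + t * x))) \<partial>lborel)"
      by (rule nn_integral_cmult) measurable
    also have "(\<integral>\<^sup>+v. ennreal (w v * exp (v * (c + t * x))) \<partial>lborel) = ennreal (G x)"
      unfolding val[symmetric] using int by (rule nn_integral_eq_integral) (simp add: w0)
    finally have "ennreal (?N x * G x) = (\<integral>\<^sup>+v. ennreal (w v * (?N x * exp (v * c + v * t * x))) \<partial>lborel)"
      by (simp add: ennreal_mult')
    moreover have "G x \<ge> 0" unfolding val[symmetric] by (rule Bochner_Integration.integral_nonneg) (simp add: w0)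
    ultimately show ?case by simp
  qed
  show "(\<lambda>x. ?N x * G x) \<in> borel_measurable lborel" by measurable
  show "AE x in lborel. 0 \<le> ?N x * G x" using eqG by eventually_elim simp
  have int: "integrable lborel (\<lambda>v. w v * exp (v * c + s\<^sup>2 * (v * t)\<^sup>2 / 2))"
    and val: "(\<integral>v. w v * exp (v * c + s\<^sup>2 * (v * t)\<^sup>2 / 2) \<partial>lborel) = m"
    using m by (auto simp: has_bochner_integral_iff)
  show "0 \<le> m" unfolding val[symmetric] by (rule Bochner_Integration.integral_nonneg) (simp add: w0)
  have "(\<integral>\<^sup>+x. ennreal (?N x * G x) \<partial>lborel) =
      (\<integral>\<^sup>+x. (\<integral>\<^sup>+v. ennreal (w v * (?N x * exp (v * c + v * t * x))) \<partial>lborel) \<partial>lborel)"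
    using eqG by (intro nn_integral_cong_AE) (auto elim: eventually_mono)
  also have "\<dots> = (\<integral>\<^sup>+v. (\<integral>\<^sup>+x. ennreal (w v * (?N x * exp (v * c + v * t * x))) \<partial>lborel) \<partial>lborel)"
    by (rule lborel_pair.Fubini') measurable
  also have "\<dots> = (\<integral>\<^sup>+v. ennreal (w v * exp (v * c + s\<^sup>2 * (v * t)\<^sup>2 / 2)) \<partial>lborel)"
  proof (rule nn_integral_cong)
    fix v
    have b: "has_bochner_integral lborel (\<lambda>x. ?N x * exp (v * c + v * t * x)) (exp (v * c + s\<^sup>2 * (v * t)\<^sup>2 / 2))"
      by (rule has_bochner_integral_normal_exp[OF s])
    have "(\<integral>\<^sup>+x. ennreal (w v * (?N x * exp (v * c + v * t * x))) \<partial>lborel) =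
        ennreal (w v) * (\<integral>\<^sup>+x. ennreal (?N x * exp (v * c + v * t * x)) \<partial>lborel)"
      by (simp add: ennreal_mult' w0 nn_integral_cmult)
    also have "(\<integral>\<^sup>+x. ennreal (?N x * exp (v * c + v * t * x)) \<partial>lborel) = exp (v * c + s\<^sup>2 * (v * t)\<^sup>2 / 2)"
      using b by (subst nn_integral_eq_integral) (auto simp: has_bochner_integral_iff)
    finally show "(\<integral>\<^sup>+x. ennreal (w v * (?N x * exp (v * c + v * t * x))) \<partial>lborel) =
        ennreal (w v * exp (v * c + s\<^sup>2 * (v * t)\<^sup>2 / 2))"
      by (simp add: ennreal_mult' w0)
  qed
  also have "\<dots> = ennreal m"
    unfolding val[symmetric] using int by (rule nn_integral_eq_integral) (simp add: w0)
  finally show "(\<integral>\<^sup>+x. ennreal (?N x * G x) \<partial>lborel) = ennreal m" .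
qed

section \<open>The imaginary error function and the closed forms of L, L tilde and L bar\<close>

lemma erfi_has_real_derivative: "(erfi has_real_derivative 2 / sqrt pi * exp (x\<^sup>2)) (at x)"
proof -
  \<comment> \<open>The fundamental theorem is applied on a compact interval; this one contains the
    base point 0 and has x in its interior, so the derivative within it is the full
    derivative.\<close>
  define b where "b = \<bar>x\<bar> + 1"
  have "((\<lambda>u. LBINT y=ereal 0..ereal u. exp (y\<^sup>2)) has_vector_derivative exp (x\<^sup>2)) (at x within {-b..b})"
    by (rule interval_integral_FTC2) (auto simp: b_def intro!: continuous_intros)
  moreover have "at x within {-b..b} = at x"
    by (rule at_within_interior) (auto simp: b_def)
  ultimately have "((\<lambda>u. LBINT y=ereal 0..ereal u. exp (y\<^sup>2)) has_real_derivative exp (x\<^sup>2)) (at x)"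
    by (simp add: has_real_derivative_iff_has_vector_derivative)
  from DERIV_cmult[OF this, of "2 / sqrt pi"] show ?thesis
    by (simp add: erfi_def[abs_def] zero_ereal_def)
qed

lemma erfi_minus: "erfi (- x) = - erfi x"
proof -
  have "(LBINT u=0..ereal (-x). exp (u\<^sup>2)) = (LBINT u=ereal x..0. exp (u\<^sup>2))"
    by (subst interval_integral_reflect) simp
  also have "\<dots> = - (LBINT u=0..ereal x. exp (u\<^sup>2))" by (rule interval_integral_endpoints_reverse)
  finally show ?thesis by (simp add: erfi_def)
qed

text \<open>An antiderivative of \<open>\<lambda>v. exp (- a * \<Delta> * v + \<sigma>\<^sup>2 * \<Delta> * v\<^sup>2 / 2)\<close>, the moment generating function
  of the exponent of \<open>igbm_X\<close>; it comes from completing the square.\<close>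

definition exp_quadratic_prim :: "real \<Rightarrow> real \<Rightarrow> real \<Rightarrow> real \<Rightarrow> real" where
  "exp_quadratic_prim a \<sigma> \<Delta> v =
     sqrt pi / (\<sigma> * sqrt (2 * \<Delta>)) * exp (- (a\<^sup>2 * \<Delta>) / (2 * \<sigma>\<^sup>2))
       * erfi ((v * \<sigma>\<^sup>2 - a) * sqrt \<Delta> / (\<sigma> * sqrt 2))"

text \<open>The prefactor of erfi is the reciprocal of 2 / sqrt pi times the slope of its argument,
  and the constant exponential is what remains after completing the square.\<close>

lemma exp_quadratic_prim_derivative:
  assumes "\<sigma> > 0" "\<Delta> > 0"
  shows "(exp_quadratic_prim a \<sigma> \<Delta> has_real_derivative exp (v * (- a * \<Delta>) + \<sigma>\<^sup>2 * \<Delta> * v\<^sup>2 / 2)) (at v)"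
proof -
  let ?w = "\<lambda>v. (v * \<sigma>\<^sup>2 - a) * sqrt \<Delta> / (\<sigma> * sqrt 2)"
  have "(?w has_real_derivative \<sigma>\<^sup>2 * sqrt \<Delta> / (\<sigma> * sqrt 2)) (at v)"
    using assms by (auto intro!: derivative_eq_intros simp: field_simps)
  from DERIV_cmult[OF DERIV_chain2[OF erfi_has_real_derivative this]]
  have *: "(exp_quadratic_prim a \<sigma> \<Delta> has_real_derivative
      sqrt pi / (\<sigma> * sqrt (2 * \<Delta>)) * exp (- (a\<^sup>2 * \<Delta>) / (2 * \<sigma>\<^sup>2)) *
      (2 / sqrt pi * exp ((?w v)\<^sup>2) * (\<sigma>\<^sup>2 * sqrt \<Delta> / (\<sigma> * sqrt 2)))) (at v)"
    unfolding exp_quadratic_prim_def[abs_def] .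
  have w2: "(?w v)\<^sup>2 = (v * \<sigma>\<^sup>2 - a)\<^sup>2 * \<Delta> / (2 * \<sigma>\<^sup>2)"
    using assms by (simp add: power_mult_distrib power_divide)
  have ex: "- (a\<^sup>2 * \<Delta>) / (2 * \<sigma>\<^sup>2) + (?w v)\<^sup>2 = v * (- a * \<Delta>) + \<sigma>\<^sup>2 * \<Delta> * v\<^sup>2 / 2"
    unfolding w2 using assms by (simp add: field_simps power2_eq_square)
  have "\<sigma>\<^sup>2 * sqrt \<Delta> / (\<sigma> * sqrt 2) = \<sigma> * sqrt \<Delta> / sqrt 2"
    using assms by (simp add: power2_eq_square)
  then have c: "sqrt pi / (\<sigma> * sqrt (2 * \<Delta>)) * (2 / sqrt pi) * (\<sigma>\<^sup>2 * sqrt \<Delta> / (\<sigma> * sqrt 2)) = 1"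
    using assms by (simp add: real_sqrt_mult)
  have regroup: "x * y * (z * t * u) = (x * z * u) * (y * t)" for x y z t u :: real by simp
  have "sqrt pi / (\<sigma> * sqrt (2 * \<Delta>)) * exp (- (a\<^sup>2 * \<Delta>) / (2 * \<sigma>\<^sup>2)) *
      (2 / sqrt pi * exp ((?w v)\<^sup>2) * (\<sigma>\<^sup>2 * sqrt \<Delta> / (\<sigma> * sqrt 2))) =
      (sqrt pi / (\<sigma> * sqrt (2 * \<Delta>)) * (2 / sqrt pi) * (\<sigma>\<^sup>2 * sqrt \<Delta> / (\<sigma> * sqrt 2))) *
      exp (- (a\<^sup>2 * \<Delta>) / (2 * \<sigma>\<^sup>2) + (?w v)\<^sup>2)"
    unfolding exp_add by (rule regroup)
  also have "\<dots> = exp (v * (- a * \<Delta>) + \<sigma>\<^sup>2 * \<Delta> * v\<^sup>2 / 2)" unfolding c ex by simp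
  finally show ?thesis using * by simp
qed

text \<open>At v = 0 the antiderivative evaluates erfi at a negative multiple of a. Oddness of erfi
  turns the difference of the two end values into the sum that defines L.\<close>

lemma igbm_L_eq_prim:
  "igbm_L \<tau> \<sigma> \<Delta> = exp_quadratic_prim (igbm_a \<tau> \<sigma>) \<sigma> \<Delta> 1 - exp_quadratic_prim (igbm_a \<tau> \<sigma>) \<sigma> \<Delta> 0"
proof -
  have "(0 * \<sigma>\<^sup>2 - igbm_a \<tau> \<sigma>) * sqrt \<Delta> / (\<sigma> * sqrt 2) = - ((1 / \<tau> + \<sigma>\<^sup>2 / 2) * sqrt \<Delta> / (\<sigma> * sqrt 2))"
    by (simp only: igbm_a_def mult_zero_left diff_0 mult_minus_left minus_divide_left[symmetric])
  moreover have "1 * \<sigma>\<^sup>2 - igbm_a \<tau> \<sigma> = - (1 / \<tau>) + \<sigma>\<^sup>2 / 2" by (simp add: igbm_a_def)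
  ultimately show ?thesis
    unfolding igbm_L_def exp_quadratic_prim_def
    by (simp only: erfi_minus) (simp add: igbm_a_def algebra_simps)
qed

text \<open>L tilde stands for E(X \<alpha>) divided by E X = exp(- \<Delta> / \<tau>), and this
  division is hidden in its exponent: (1/\<tau> + \<sigma>^2/2)^2 - (1/\<tau> - \<sigma>^2/2)^2 = 2
  \<sigma>^2 / \<tau>, which times \<Delta> / (2 \<sigma>^2) is \<Delta> / \<tau>.\<close>

lemma igbm_L_tilde_eq_prim:
  assumes "\<sigma> > 0"
  shows "exp (- \<Delta> / \<tau>) * igbm_L_tilde \<tau> \<sigma> \<Delta> =
    exp_quadratic_prim (igbm_a \<tau> \<sigma>) \<sigma> \<Delta> 2 - exp_quadratic_prim (igbm_a \<tau> \<sigma>) \<sigma> \<Delta> 1"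
proof -
  have 1: "(1 * \<sigma>\<^sup>2 - igbm_a \<tau> \<sigma>) * sqrt \<Delta> / (\<sigma> * sqrt 2) = - ((1 / \<tau> - \<sigma>\<^sup>2 / 2) * sqrt \<Delta> / (\<sigma> * sqrt 2))"
    by (simp add: igbm_a_def algebra_simps diff_divide_distrib add_divide_distrib)
  have 2: "2 * \<sigma>\<^sup>2 - igbm_a \<tau> \<sigma> = - (1 / \<tau>) + 3 * \<sigma>\<^sup>2 / 2" by (simp add: igbm_a_def)
  define u where "u = 1 / \<tau>"
  have "- \<Delta> / \<tau> + - ((1 / \<tau> - \<sigma>\<^sup>2 / 2)\<^sup>2 * \<Delta>) / (2 * \<sigma>\<^sup>2) = - ((igbm_a \<tau> \<sigma>)\<^sup>2 * \<Delta>) / (2 * \<sigma>\<^sup>2)"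
  proof -
    have "- \<Delta> * u + - ((u - \<sigma>\<^sup>2 / 2)\<^sup>2 * \<Delta>) / (2 * \<sigma>\<^sup>2) = - ((u + \<sigma>\<^sup>2 / 2)\<^sup>2 * \<Delta>) / (2 * \<sigma>\<^sup>2)"
      using assms by (simp add: field_simps power2_eq_square)
    then show ?thesis by (simp add: u_def igbm_a_def)
  qed
  then have e: "exp (- \<Delta> / \<tau>) * exp (- ((1 / \<tau> - \<sigma>\<^sup>2 / 2)\<^sup>2 * \<Delta>) / (2 * \<sigma>\<^sup>2)) =
      exp (- ((igbm_a \<tau> \<sigma>)\<^sup>2 * \<Delta>) / (2 * \<sigma>\<^sup>2))"
    by (simp only: exp_add[symmetric])
  show ?thesis
    unfolding igbm_L_tilde_def exp_quadratic_prim_def 1 2 erfi_minus e[symmetric]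
    by (simp only: algebra_simps)
qed

text \<open>The right-hand side is the integral of E against the tent that rises on [0, 1] and falls
  on [1, 2]. With F = (E + a \<Delta> P) / (\<sigma>^2 \<Delta>), an antiderivative of v E(v), it
  equals 2 F(1) - F(0) - F(2) + 2 (P(2) - P(1)); the last term comes from the 2 in the weight 2 -
  v.\<close>

lemma igbm_L_bar_eq_prim:
  fixes \<tau> \<sigma> \<Delta> :: real
  assumes "\<sigma> > 0" "\<Delta> > 0" "\<tau> > 0"
  defines "a \<equiv> igbm_a \<tau> \<sigma>"
  defines "E \<equiv> \<lambda>v. exp (v * (- a * \<Delta>) + \<sigma>\<^sup>2 * \<Delta> * v\<^sup>2 / 2)"
  defines "P \<equiv> exp_quadratic_prim a \<sigma> \<Delta>"
  shows "igbm_L_bar \<tau> \<sigma> \<Delta> =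
    (2 * E 1 - E 0 - E 2 + a * \<Delta> * (2 * P 1 - P 0 - P 2) + 2 * \<sigma>\<^sup>2 * \<Delta> * (P 2 - P 1)) / (\<sigma>\<^sup>2 * \<Delta>)"
proof -
  define k where "k = sqrt \<Delta> / (\<sigma> * sqrt 2)"
  define e where "e = exp (- (a\<^sup>2 * \<Delta>) / (2 * \<sigma>\<^sup>2))"
  have P: "P v = sqrt pi / (\<sigma> * sqrt (2 * \<Delta>)) * e * erfi ((v * \<sigma>\<^sup>2 - a) * k)" for v
    by (simp add: P_def exp_quadratic_prim_def e_def k_def)
  have erf: "erfi ((v * \<sigma>\<^sup>2 - a) * k) = - erfi ((a - v * \<sigma>\<^sup>2) * k)" for v
    unfolding erfi_minus[symmetric] by (simp add: algebra_simps)
  have args: "(1 / \<tau> + \<sigma>\<^sup>2 / 2) * sqrt \<Delta> / (\<sigma> * sqrt 2) = (a - 0 * \<sigma>\<^sup>2) * k"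
    "(1 / \<tau> - 3 * \<sigma>\<^sup>2 / 2) * sqrt \<Delta> / (\<sigma> * sqrt 2) = (a - 2 * \<sigma>\<^sup>2) * k"
    "(1 / \<tau> - \<sigma>\<^sup>2 / 2) * sqrt \<Delta> / (\<sigma> * sqrt 2) = (a - 1 * \<sigma>\<^sup>2) * k"
    by (simp_all add: a_def igbm_a_def k_def)
  have 1: "- (1 / \<tau>) + \<sigma>\<^sup>2 / 2 = \<sigma>\<^sup>2 - a" by (simp add: a_def igbm_a_def)
  \<comment> \<open>In this form the two exponential prefactors of L bar multiply to exp(- 2 a
    \<Delta>), which turns its bracket of exponentials into E(0) + E(2) - 2 E(1).\<close>
  have as: "1 / (\<tau> * \<sigma>\<^sup>2) + 1 / 2 = a / \<sigma>\<^sup>2" using assms(1,3) by (simp add: a_def igbm_a_def field_simps)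
  have "- (a\<^sup>2 * \<Delta>) / (2 * \<sigma>\<^sup>2) + a * \<Delta> / 2 * (- 4 + a / \<sigma>\<^sup>2) = - 2 * a * \<Delta>"
    using assms(1) by (simp add: field_simps power2_eq_square)
  then have "e * exp (a * \<Delta> / 2 * (- 4 + a / \<sigma>\<^sup>2)) = exp (- 2 * a * \<Delta>)"
    unfolding e_def by (simp only: exp_add[symmetric])
  then have ee: "e * (exp (a * \<Delta> / 2 * (- 4 + a / \<sigma>\<^sup>2)) *
      (exp (2 * a * \<Delta>) + exp (2 * \<sigma>\<^sup>2 * \<Delta>) - 2 * exp (a * \<Delta> + \<sigma>\<^sup>2 / 2 * \<Delta>))) =
      exp (- 2 * a * \<Delta>) * (exp (2 * a * \<Delta>) + exp (2 * \<sigma>\<^sup>2 * \<Delta>) - 2 * exp (a * \<Delta> + \<sigma>\<^sup>2 / 2 * \<Delta>))"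
    by simp
  also have "\<dots> = E 0 + E 2 - 2 * E 1"
    by (simp add: E_def algebra_simps exp_add[symmetric])
  finally have ee: "e * (exp (a * \<Delta> / 2 * (- 4 + a / \<sigma>\<^sup>2)) *
      (exp (2 * a * \<Delta>) + exp (2 * \<sigma>\<^sup>2 * \<Delta>) - 2 * exp (a * \<Delta> + \<sigma>\<^sup>2 / 2 * \<Delta>))) = E 0 + E 2 - 2 * E 1" .
  define C where "C = sqrt pi / (\<sigma> * sqrt (2 * \<Delta>))"
  have C: "1 / (2 * \<sigma> ^ 3 * \<Delta>) * sqrt (2 * pi * \<Delta>) = C / \<sigma>\<^sup>2"
    unfolding C_def using assms(1,2)
    by (simp add: real_sqrt_mult field_simps power2_eq_square power3_eq_cube)
  \<comment> \<open>Opaque names for the values of erfi and of the exponentials, so that a rational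
    identity is all that is left to the simplifier.\<close>
  define x0 x1 x2 where "x0 = erfi ((a - 0 * \<sigma>\<^sup>2) * k)" and "x1 = erfi ((a - 1 * \<sigma>\<^sup>2) * k)"
    and "x2 = erfi ((a - 2 * \<sigma>\<^sup>2) * k)"
  define B where "B = exp (2 * a * \<Delta>) + exp (2 * \<sigma>\<^sup>2 * \<Delta>) - 2 * exp (a * \<Delta> + \<sigma>\<^sup>2 / 2 * \<Delta>)"
  define D where "D = exp (a * \<Delta> / 2 * (- 4 + a / \<sigma>\<^sup>2))"
  have "igbm_L_bar \<tau> \<sigma> \<Delta> = 1 / (2 * \<sigma> ^ 3 * \<Delta>) * e * (- 2 * \<sigma> * D * B
      + sqrt (2 * pi * \<Delta>) * (x0 * a + x2 * (a - 2 * \<sigma>\<^sup>2) + x1 * 2 * (\<sigma>\<^sup>2 - a)))"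
    unfolding igbm_L_bar_def Let_def a_def[symmetric] args 1 as
    unfolding e_def[symmetric] x0_def x1_def x2_def B_def D_def ..
  also have "\<dots> = (1 / (2 * \<sigma> ^ 3 * \<Delta>) * (- 2 * \<sigma>)) * (e * (D * B))
      + (1 / (2 * \<sigma> ^ 3 * \<Delta>) * sqrt (2 * pi * \<Delta>)) * e * (x0 * a + x2 * (a - 2 * \<sigma>\<^sup>2) + x1 * 2 * (\<sigma>\<^sup>2 - a))"
    by (simp only: algebra_simps)
  also have "e * (D * B) = E 0 + E 2 - 2 * E 1" unfolding D_def B_def by (rule ee)
  also have "1 / (2 * \<sigma> ^ 3 * \<Delta>) * (- 2 * \<sigma>) = - 1 / (\<sigma>\<^sup>2 * \<Delta>)"
    using assms(1,2) by (simp add: field_simps power2_eq_square power3_eq_cube)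
  also have "- 1 / (\<sigma>\<^sup>2 * \<Delta>) * (E 0 + E 2 - 2 * E 1) +
      1 / (2 * \<sigma> ^ 3 * \<Delta>) * sqrt (2 * pi * \<Delta>) * e * (x0 * a + x2 * (a - 2 * \<sigma>\<^sup>2) + x1 * 2 * (\<sigma>\<^sup>2 - a)) =
      (2 * E 1 - E 0 - E 2 + a * \<Delta> * (2 * P 1 - P 0 - P 2) + 2 * \<sigma>\<^sup>2 * \<Delta> * (P 2 - P 1)) / (\<sigma>\<^sup>2 * \<Delta>)"
    unfolding C P erf C_def[symmetric] x0_def[symmetric] x1_def[symmetric] x2_def[symmetric]
    using assms(1,2) by (simp add: field_simps)
  finally show ?thesis .
qed

section \<open>Moments of X and \<alpha> under one Wiener increment\<close>

lemma AE_lborel_affine_nonzero: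
  fixes c t :: real
  assumes "t \<noteq> 0"
  shows "AE x in lborel. c + t * x \<noteq> 0"
  using AE_lborel_singleton[of "- c / t"]
proof eventually_elim
  case (elim x)
  have "x = - c / t" if "c + t * x = 0" using that assms by (simp add: field_simps)
  with elim show ?case by auto
qed

lemma has_bochner_integral_exp_Icc:
  fixes z :: real
  assumes "z \<noteq> 0" "a \<le> b"
  shows "has_bochner_integral lborel (\<lambda>v. exp (v * z) * indicator {a..b} v) (exp (b * z) / z - exp (a * z) / z)"
  using assms
  by (intro has_bochner_integral_FTC_Icc_real) (auto intro!: derivative_eq_intros)

text \<open>Squaring the integral of exp(v z) over [0, 1] convolves the uniform weight with itself.
  Instead of a convolution, the result is checked with antiderivatives from integration by parts on
  either side of the kink v = 1. Both indicators contain this point, a null set.\<close>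

lemma has_bochner_integral_tent_exp:
  fixes z :: real
  assumes "z \<noteq> 0"
  shows "has_bochner_integral lborel
    (\<lambda>v. v * exp (v * z) * indicator {0..1} v + (2 - v) * exp (v * z) * indicator {1..2} v)
    (((exp z - 1) / z)\<^sup>2)"
proof -
  let ?F = "\<lambda>v. (v / z - 1 / z\<^sup>2) * exp (v * z)"
  let ?G = "\<lambda>v. ((2 - v) / z + 1 / z\<^sup>2) * exp (v * z)"
  have 1: "has_bochner_integral lborel (\<lambda>v. v * exp (v * z) * indicator {0..1} v) (?F 1 - ?F 0)"
    using assms by (intro has_bochner_integral_FTC_Icc_real)
      (auto intro!: derivative_eq_intros simp: field_simps power2_eq_square)
  have 2: "has_bochner_integral lborel (\<lambda>v. (2 - v) * exp (v * z) * indicator {1..2} v) (?G 2 - ?G 1)"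
    using assms by (intro has_bochner_integral_FTC_Icc_real)
      (auto intro!: derivative_eq_intros simp: field_simps power2_eq_square)
  have "exp (2 * z) = exp z * exp z" by (simp add: exp_add[symmetric])
  then have "(?F 1 - ?F 0) + (?G 2 - ?G 1) = ((exp z - 1) / z)\<^sup>2"
    using assms by (simp add: field_simps power2_eq_square)
  with has_bochner_integral_add[OF 1 2] show ?thesis by simp
qed

lemma igbm_X_measurable [measurable]: "igbm_X \<tau> \<sigma> \<Delta> \<in> borel_measurable borel"
  unfolding igbm_X_def[abs_def] by measurable

lemma igbm_alpha_measurable [measurable]: "igbm_alpha \<tau> \<sigma> \<Delta> \<in> borel_measurable borel"
  unfolding igbm_alpha_def[abs_def] by measurable

context
  fixes \<tau> \<sigma> \<Delta> :: real
  assumes pos: "\<tau> > 0" "\<sigma> > 0" "\<Delta> > 0"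
begin

text \<open>The summand \<sigma>^2 / 2 of a is exactly what the variance term of the moment
  generating function cancels, so that only the drift - \<Delta> / \<tau> survives.\<close>

lemma has_bochner_integral_igbm_X:
  "has_bochner_integral lborel (\<lambda>x. normal_density 0 (sqrt \<Delta>) x * igbm_X \<tau> \<sigma> \<Delta> x) (exp (- \<Delta> / \<tau>))"
proof -
  have "has_bochner_integral lborel (\<lambda>x. normal_density 0 (sqrt \<Delta>) x * exp ((- igbm_a \<tau> \<sigma> * \<Delta>) + \<sigma> * x)) (exp ((- igbm_a \<tau> \<sigma> * \<Delta>) + (sqrt \<Delta>)\<^sup>2 * \<sigma>\<^sup>2 / 2))"
    using pos by (intro has_bochner_integral_normal_exp) simp
  moreover have "(- igbm_a \<tau> \<sigma> * \<Delta>) + (sqrt \<Delta>)\<^sup>2 * \<sigma>\<^sup>2 / 2 = - \<Delta> / \<tau>"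
    using pos by (simp add: igbm_a_def algebra_simps)
  ultimately show ?thesis by (simp add: igbm_X_def)
qed

lemma has_bochner_integral_igbm_X_square:
  "has_bochner_integral lborel (\<lambda>x. normal_density 0 (sqrt \<Delta>) x * (igbm_X \<tau> \<sigma> \<Delta> x)\<^sup>2)
     (exp (\<sigma>\<^sup>2 * \<Delta> - 2 * \<Delta> / \<tau>))"
proof -
  have "has_bochner_integral lborel (\<lambda>x. normal_density 0 (sqrt \<Delta>) x * exp (2 * (- igbm_a \<tau> \<sigma> * \<Delta>) + (2 * \<sigma>) * x)) (exp (2 * (- igbm_a \<tau> \<sigma> * \<Delta>) + (sqrt \<Delta>)\<^sup>2 * (2 * \<sigma>)\<^sup>2 / 2))"
    using pos by (intro has_bochner_integral_normal_exp) simp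
  moreover have "2 * (- igbm_a \<tau> \<sigma> * \<Delta>) + (sqrt \<Delta>)\<^sup>2 * (2 * \<sigma>)\<^sup>2 / 2 = \<sigma>\<^sup>2 * \<Delta> - 2 * \<Delta> / \<tau>"
    using pos by (simp add: igbm_a_def algebra_simps)
  moreover have "(igbm_X \<tau> \<sigma> \<Delta> x)\<^sup>2 = exp (2 * (- igbm_a \<tau> \<sigma> * \<Delta>) + (2 * \<sigma>) * x)" for x
    by (simp add: igbm_X_def power2_eq_square exp_add[symmetric] algebra_simps)
  ultimately show ?thesis by simp
qed

lemma variance_exponent: "v * (- igbm_a \<tau> \<sigma> * \<Delta>) + (sqrt \<Delta>)\<^sup>2 * (v * \<sigma>)\<^sup>2 / 2 = v * (- igbm_a \<tau> \<sigma> * \<Delta>) + \<sigma>\<^sup>2 * \<Delta> * v\<^sup>2 / 2"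
  using pos by (simp add: power_mult_distrib algebra_simps)

lemma has_bochner_integral_exp_quadratic_Icc:
  assumes "l \<le> u"
  shows "has_bochner_integral lborel (\<lambda>v. indicator {l..u} v * exp (v * (- igbm_a \<tau> \<sigma> * \<Delta>) + \<sigma>\<^sup>2 * \<Delta> * v\<^sup>2 / 2))
    (exp_quadratic_prim (igbm_a \<tau> \<sigma>) \<sigma> \<Delta> u - exp_quadratic_prim (igbm_a \<tau> \<sigma>) \<sigma> \<Delta> l)"
  using has_bochner_integral_FTC_Icc_real[OF assms exp_quadratic_prim_derivative[OF pos(2,3), where a = "igbm_a \<tau> \<sigma>"]]
  by (simp add: mult.commute)

text \<open>Since \<open>(exp z - 1) / z = \<integral>\<^sub>0\<^sup>1 exp (v * z) dv\<close>, the expectations below are integrals of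
  the moment generating function, over \<open>v \<in> [0, 1]\<close>, over \<open>v \<in> [1, 2]\<close>, and over \<open>v \<in> [0, 2]\<close>
  with a tent weight (the density of the sum of two uniform variables).\<close>

lemma has_bochner_integral_igbm_alpha:
  "has_bochner_integral lborel (\<lambda>x. normal_density 0 (sqrt \<Delta>) x * igbm_alpha \<tau> \<sigma> \<Delta> x) (igbm_L \<tau> \<sigma> \<Delta>)"
proof (rule has_bochner_integral_normal_exp_mixture[where w = "indicator {0..1}" and c = "- igbm_a \<tau> \<sigma> * \<Delta>" and t = \<sigma>])
  show "AE x in lborel. has_bochner_integral lborel (\<lambda>v. indicator {0..1} v * exp (v * ((- igbm_a \<tau> \<sigma> * \<Delta>) + \<sigma> * x))) (igbm_alpha \<tau> \<sigma> \<Delta> x)"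
    using AE_lborel_affine_nonzero[of \<sigma> "- igbm_a \<tau> \<sigma> * \<Delta>"]
  proof (rule eventually_mono)
    show "has_bochner_integral lborel (\<lambda>v. indicator {0..1} v * exp (v * ((- igbm_a \<tau> \<sigma> * \<Delta>) + \<sigma> * x))) (igbm_alpha \<tau> \<sigma> \<Delta> x)"
      if "(- igbm_a \<tau> \<sigma> * \<Delta>) + \<sigma> * x \<noteq> 0" for x
      using has_bochner_integral_exp_Icc[OF that, of 0 1]
      by (simp add: igbm_alpha_def diff_divide_distrib mult.commute)
  qed (use pos in simp)
  show "has_bochner_integral lborel (\<lambda>v. indicator {0..1} v * exp (v * (- igbm_a \<tau> \<sigma> * \<Delta>) + (sqrt \<Delta>)\<^sup>2 * (v * \<sigma>)\<^sup>2 / 2)) (igbm_L \<tau> \<sigma> \<Delta>)"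
    unfolding variance_exponent igbm_L_eq_prim by (rule has_bochner_integral_exp_quadratic_Icc) simp
qed (use pos in auto)

lemma has_bochner_integral_igbm_X_alpha:
  "has_bochner_integral lborel (\<lambda>x. normal_density 0 (sqrt \<Delta>) x * (igbm_X \<tau> \<sigma> \<Delta> x * igbm_alpha \<tau> \<sigma> \<Delta> x))
     (exp (- \<Delta> / \<tau>) * igbm_L_tilde \<tau> \<sigma> \<Delta>)"
proof (rule has_bochner_integral_normal_exp_mixture[where w = "indicator {1..2}" and c = "- igbm_a \<tau> \<sigma> * \<Delta>" and t = \<sigma>])
  show "AE x in lborel. has_bochner_integral lborel (\<lambda>v. indicator {1..2} v * exp (v * ((- igbm_a \<tau> \<sigma> * \<Delta>) + \<sigma> * x)))
      (igbm_X \<tau> \<sigma> \<Delta> x * igbm_alpha \<tau> \<sigma> \<Delta> x)"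
    using AE_lborel_affine_nonzero[of \<sigma> "- igbm_a \<tau> \<sigma> * \<Delta>"]
  proof (rule eventually_mono)
    show "has_bochner_integral lborel (\<lambda>v. indicator {1..2} v * exp (v * ((- igbm_a \<tau> \<sigma> * \<Delta>) + \<sigma> * x))) (igbm_X \<tau> \<sigma> \<Delta> x * igbm_alpha \<tau> \<sigma> \<Delta> x)"
      if "(- igbm_a \<tau> \<sigma> * \<Delta>) + \<sigma> * x \<noteq> 0" for x
    proof -
      define z where "z = (- igbm_a \<tau> \<sigma> * \<Delta>) + \<sigma> * x"
      have "exp (2 * z) = exp z * exp z" by (simp add: exp_add[symmetric])
      then have "exp (2 * z) / z - exp (1 * z) / z = exp z * ((exp z - 1) / z)"
        by (simp add: algebra_simps diff_divide_distrib)
      then show ?thesis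
        using has_bochner_integral_exp_Icc[OF that, of 1 2]
        by (simp add: igbm_alpha_def igbm_X_def z_def mult.commute)
    qed
  qed (use pos in simp)
  show "has_bochner_integral lborel (\<lambda>v. indicator {1..2} v * exp (v * (- igbm_a \<tau> \<sigma> * \<Delta>) + (sqrt \<Delta>)\<^sup>2 * (v * \<sigma>)\<^sup>2 / 2))
      (exp (- \<Delta> / \<tau>) * igbm_L_tilde \<tau> \<sigma> \<Delta>)"
    unfolding variance_exponent igbm_L_tilde_eq_prim[OF pos(2)]
    by (rule has_bochner_integral_exp_quadratic_Icc) simp
qed (use pos in auto)

lemma has_bochner_integral_igbm_alpha_square:
  "has_bochner_integral lborel (\<lambda>x. normal_density 0 (sqrt \<Delta>) x * (igbm_alpha \<tau> \<sigma> \<Delta> x)\<^sup>2) (igbm_L_bar \<tau> \<sigma> \<Delta>)"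
proof (rule has_bochner_integral_normal_exp_mixture[where
      w = "\<lambda>v. v * indicator {0..1} v + (2 - v) * indicator {1..2} v" and c = "- igbm_a \<tau> \<sigma> * \<Delta>" and t = \<sigma>])
  let ?w = "\<lambda>v::real. v * indicator {0..1} v + (2 - v) * indicator {1..2} v"
  show "0 \<le> ?w v" for v by (auto simp: indicator_def)
  show "AE x in lborel. has_bochner_integral lborel (\<lambda>v. ?w v * exp (v * ((- igbm_a \<tau> \<sigma> * \<Delta>) + \<sigma> * x))) ((igbm_alpha \<tau> \<sigma> \<Delta> x)\<^sup>2)"
    using AE_lborel_affine_nonzero[of \<sigma> "- igbm_a \<tau> \<sigma> * \<Delta>"]
  proof (rule eventually_mono)
    show "has_bochner_integral lborel (\<lambda>v. ?w v * exp (v * ((- igbm_a \<tau> \<sigma> * \<Delta>) + \<sigma> * x))) ((igbm_alpha \<tau> \<sigma> \<Delta> x)\<^sup>2)"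
      if "(- igbm_a \<tau> \<sigma> * \<Delta>) + \<sigma> * x \<noteq> 0" for x
      using has_bochner_integral_tent_exp[OF that]
      unfolding igbm_alpha_def distrib_right by (simp only: mult_ac)
  qed (use pos in simp)
  let ?a = "igbm_a \<tau> \<sigma>"
  define E where "E v = exp (v * (- igbm_a \<tau> \<sigma> * \<Delta>) + \<sigma>\<^sup>2 * \<Delta> * v\<^sup>2 / 2)" for v
  define P where "P = exp_quadratic_prim ?a \<sigma> \<Delta>"
  have dP: "(P has_real_derivative E v) (at v)" for v
    unfolding P_def E_def by (rule exp_quadratic_prim_derivative[OF pos(2,3)])
  have dE: "(E has_real_derivative E v * ((- igbm_a \<tau> \<sigma> * \<Delta>) + \<sigma>\<^sup>2 * \<Delta> * v)) (at v)" for v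
    unfolding E_def[abs_def] by (auto intro!: derivative_eq_intros simp: algebra_simps power2_eq_square)
  \<comment> \<open>Obtained by solving E' = (- a \<Delta> + \<sigma>^2 \<Delta> v) E for v E and
    using P' = E.\<close>
  define F where "F v = (E v + ?a * \<Delta> * P v) / (\<sigma>\<^sup>2 * \<Delta>)" for v
  have dF: "(F has_real_derivative v * E v) (at v)" for v
  proof -
    have "(F has_real_derivative (E v * ((- igbm_a \<tau> \<sigma> * \<Delta>) + \<sigma>\<^sup>2 * \<Delta> * v) + ?a * \<Delta> * E v) / (\<sigma>\<^sup>2 * \<Delta>)) (at v)"
      unfolding F_def[abs_def] by (intro DERIV_cdivide DERIV_add DERIV_cmult dE dP)
    moreover have "(E v * ((- igbm_a \<tau> \<sigma> * \<Delta>) + \<sigma>\<^sup>2 * \<Delta> * v) + ?a * \<Delta> * E v) / (\<sigma>\<^sup>2 * \<Delta>) = v * E v"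
      using pos by (simp add: field_simps)
    ultimately show ?thesis by simp
  qed
  have contE: "isCont E v" for v using dE by (rule DERIV_isCont)
  have 1: "has_bochner_integral lborel (\<lambda>v. v * E v * indicator {0..1} v) (F 1 - F 0)"
    by (rule has_bochner_integral_FTC_Icc_real) (auto intro!: dF contE continuous_intros)
  have dG: "((\<lambda>v. 2 * P v - F v) has_real_derivative (2 - v) * E v) (at v)" for v
    using DERIV_diff[OF DERIV_cmult[OF dP, of 2] dF, of v] by (simp add: algebra_simps)
  have 2: "has_bochner_integral lborel (\<lambda>v. (2 - v) * E v * indicator {1..2} v) ((2 * P 2 - F 2) - (2 * P 1 - F 1))"
    by (rule has_bochner_integral_FTC_Icc_real) (auto intro!: dG contE continuous_intros)
  have "F 1 - F 0 + ((2 * P 2 - F 2) - (2 * P 1 - F 1)) =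
      (2 * E 1 - E 0 - E 2 + ?a * \<Delta> * (2 * P 1 - P 0 - P 2) + 2 * \<sigma>\<^sup>2 * \<Delta> * (P 2 - P 1)) / (\<sigma>\<^sup>2 * \<Delta>)"
    using pos unfolding F_def by (simp add: field_simps)
  also have "\<dots> = igbm_L_bar \<tau> \<sigma> \<Delta>"
    unfolding igbm_L_bar_eq_prim[OF pos(2,3,1)] E_def P_def ..
  finally have v: "F 1 - F 0 + ((2 * P 2 - F 2) - (2 * P 1 - F 1)) = igbm_L_bar \<tau> \<sigma> \<Delta>" .
  show "has_bochner_integral lborel (\<lambda>v. ?w v * exp (v * (- igbm_a \<tau> \<sigma> * \<Delta>) + (sqrt \<Delta>)\<^sup>2 * (v * \<sigma>)\<^sup>2 / 2)) (igbm_L_bar \<tau> \<sigma> \<Delta>)"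
    using has_bochner_integral_add[OF 1 2]
    unfolding v variance_exponent E_def[symmetric] distrib_right by (simp only: mult_ac)
qed (use pos in auto)

end

section \<open>Polynomial moments of one Gaussian variable\<close>

lemma has_bochner_integral_normal_powers:
  assumes "s > 0"
  shows "has_bochner_integral lborel (\<lambda>x. normal_density 0 s x * 1) 1"
    and "has_bochner_integral lborel (\<lambda>x. normal_density 0 s x * x) 0"
    and "has_bochner_integral lborel (\<lambda>x. normal_density 0 s x * x\<^sup>2) (s\<^sup>2)"
    and "has_bochner_integral lborel (\<lambda>x. normal_density 0 s x * x ^ 3) 0"
    and "has_bochner_integral lborel (\<lambda>x. normal_density 0 s x * x ^ 4) (3 * s ^ 4)"
proof -
  show "has_bochner_integral lborel (\<lambda>x. normal_density 0 s x * 1) 1"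
    using normal_moment_even[OF assms, of 0 0] by simp
  show "has_bochner_integral lborel (\<lambda>x. normal_density 0 s x * x) 0"
    using normal_moment_odd[OF assms, of 0 0] by simp
  show "has_bochner_integral lborel (\<lambda>x. normal_density 0 s x * x\<^sup>2) (s\<^sup>2)"
    using normal_moment_even[OF assms, of 0 1] by simp
  show "has_bochner_integral lborel (\<lambda>x. normal_density 0 s x * x ^ 3) 0"
    using normal_moment_odd[OF assms, of 0 1] by (simp add: numeral_3_eq_3)
  have "fact 4 / ((2 / s\<^sup>2)\<^sup>2 * fact 2) = 3 * s ^ 4"
    using assms by (simp add: fact_numeral power_divide field_simps power2_eq_square power4_eq_xxxx)
  then show "has_bochner_integral lborel (\<lambda>x. normal_density 0 s x * x ^ 4) (3 * s ^ 4)"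
    using normal_moment_even[OF assms, of 0 2] by simp
qed

text \<open>Degree four is what the squared Milstein factor and the squared log-ODE weight require.
  The odd coefficients disappear by symmetry.\<close>

lemma has_bochner_integral_normal_quartic:
  fixes a b e f g :: real
  assumes "s > 0"
  shows "has_bochner_integral lborel
    (\<lambda>x. normal_density 0 s x * (a + b * x + e * x\<^sup>2 + f * x ^ 3 + g * x ^ 4))
    (a + e * s\<^sup>2 + 3 * g * s ^ 4)"
proof -
  note m = has_bochner_integral_normal_powers[OF assms, THEN has_bochner_integral_mult_right]
  have "has_bochner_integral lborel (\<lambda>x. a * (normal_density 0 s x * 1) + b * (normal_density 0 s x * x)
      + e * (normal_density 0 s x * x\<^sup>2) + f * (normal_density 0 s x * x ^ 3) + g * (normal_density 0 s x * x ^ 4))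
      (a * 1 + b * 0 + e * s\<^sup>2 + f * 0 + g * (3 * s ^ 4))"
    by (intro has_bochner_integral_add m)
  then show ?thesis by (simp add: algebra_simps)
qed

section \<open>Affine recursions with independent noise\<close>

text \<open>Such functions live on all families, not on the product space over S, so that functions
  with different index sets can be added and multiplied pointwise. The second clause confines the
  dependence to S; it is phrased with \<open>restrict\<close> because points of the product space
  are undefined outside S.\<close>

definition cylinder :: "'i set \<Rightarrow> (('i \<Rightarrow> real) \<Rightarrow> real) \<Rightarrow> bool" where
  "cylinder S f \<longleftrightarrow> f \<in> borel_measurable (\<Pi>\<^sub>M k\<in>S. borel) \<and> (\<forall>w. f (restrict w S) = f w)"

lemma cylinder_restrict:
  assumes "g \<in> borel_measurable (\<Pi>\<^sub>M k\<in>S. borel)"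
  shows "cylinder S (\<lambda>w. g (restrict w S))"
proof -
  have "(\<lambda>w. restrict w S) \<in> measurable (\<Pi>\<^sub>M k\<in>S. borel :: real measure) (\<Pi>\<^sub>M k\<in>S. borel)"
    by (rule measurable_restrict_subset) simp
  with assms show ?thesis unfolding cylinder_def by (auto intro: measurable_compose)
qed

lemma cylinder_mono:
  assumes "cylinder S f" "S \<subseteq> T"
  shows "cylinder T f"
proof -
  have f: "f \<in> borel_measurable (\<Pi>\<^sub>M k\<in>S. borel)" and eq: "\<And>w. f (restrict w S) = f w"
    using assms(1) by (auto simp: cylinder_def)
  have "(\<lambda>w. f (restrict w S)) \<in> borel_measurable (\<Pi>\<^sub>M k\<in>T. borel)"
    by (rule measurable_compose[OF measurable_restrict_subset[OF assms(2)] f])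
  moreover have "f (restrict w T) = f w" for w
  proof -
    have "restrict (restrict w T) S = restrict w S"
      using assms(2) by (auto simp: restrict_def fun_eq_iff)
    then show ?thesis by (metis eq)
  qed
  ultimately show ?thesis by (simp add: cylinder_def eq)
qed

lemma cylinder_coordinate:
  assumes "k \<in> S" "f \<in> borel_measurable borel"
  shows "cylinder S (\<lambda>w. f (w k))"
  using assms unfolding cylinder_def
  by (auto intro: measurable_compose[OF measurable_component_singleton])

lemma cylinder_coordinates2:
  assumes "k \<in> S" "l \<in> S" "case_prod f \<in> borel_measurable (borel \<Otimes>\<^sub>M borel)"
  shows "cylinder S (\<lambda>w. f (w k) (w l))"
proof -
  have "(\<lambda>w. (w k, w l)) \<in> measurable (\<Pi>\<^sub>M k\<in>S. borel :: real measure) (borel \<Otimes>\<^sub>M borel)"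
    using assms(1,2) by (intro measurable_Pair measurable_component_singleton)
  from measurable_compose[OF this assms(3)] show ?thesis
    using assms(1,2) by (simp add: cylinder_def)
qed

lemma cylinder_const: "cylinder S (\<lambda>w. c)"
  by (simp add: cylinder_def)

lemma cylinder_add: "cylinder S f \<Longrightarrow> cylinder S g \<Longrightarrow> cylinder S (\<lambda>w. f w + g w)"
  by (auto simp: cylinder_def)

lemma cylinder_mult: "cylinder S f \<Longrightarrow> cylinder S g \<Longrightarrow> cylinder S (\<lambda>w. f w * g w)"
  by (auto simp: cylinder_def)

text \<open>Disjoint blocks of an independent family are independent, hence so are measurable
  functions of them; the second clause of \<open>cylinder\<close> then removes the
  restrictions.\<close>

lemma indep_var_cylinder:
  fixes W :: "'i \<Rightarrow> 'a \<Rightarrow> real"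
  assumes "prob_space M" "prob_space.indep_vars M (\<lambda>_. borel) W UNIV"
    and "S \<inter> T = {}" "cylinder S f" "cylinder T g"
  shows "prob_space.indep_var M borel (\<lambda>\<omega>. f (\<lambda>k. W k \<omega>)) borel (\<lambda>\<omega>. g (\<lambda>k. W k \<omega>))"
proof -
  interpret prob_space M by fact
  have f: "f \<in> borel_measurable (\<Pi>\<^sub>M k\<in>S. borel)" "\<And>w. f (restrict w S) = f w"
    and g: "g \<in> borel_measurable (\<Pi>\<^sub>M k\<in>T. borel)" "\<And>w. g (restrict w T) = g w"
    using assms(4,5) by (auto simp: cylinder_def)
  from indep_var_compose[OF indep_var_restrict[OF assms(2,3) subset_UNIV subset_UNIV] f(1) g(1)]
  show ?thesis by (simp add: comp_def f(2) g(2))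
qed

lemma indep_of_coordinates:
  fixes W :: "'i \<Rightarrow> 'a \<Rightarrow> real"
  assumes "prob_space M" and ind: "prob_space.indep_vars M (\<lambda>_. borel) W UNIV" and "k \<notin> S"
  shows "indep_of M (W k) (\<Pi>\<^sub>M k\<in>S. borel) (\<lambda>\<omega>. restrict (\<lambda>k. W k \<omega>) S)"
proof -
  interpret prob_space M by fact
  have W: "W k \<in> borel_measurable M" for k
    using ind by (simp add: indep_vars_def)
  have "indep_var borel (\<lambda>\<omega>. f (W k \<omega>)) borel (\<lambda>\<omega>. g (restrict (\<lambda>k. W k \<omega>) S))"
    if "f \<in> borel_measurable borel" "g \<in> borel_measurable (\<Pi>\<^sub>M k\<in>S. borel)" for f g :: "_ \<Rightarrow> real"
    using indep_var_cylinder[OF assms(1) ind, of "{k}" S, OF _ cylinder_coordinate[OF _ that(1), of k] cylinder_restrict[OF that(2)]]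
      assms(3) by simp
  moreover have "(\<lambda>\<omega>. restrict (\<lambda>k. W k \<omega>) S) \<in> measurable M (\<Pi>\<^sub>M k\<in>S. borel)"
    by (rule measurable_restrict) (rule W)
  ultimately show ?thesis using W by (simp add: indep_of_def)
qed

text \<open>This is P of the overview after n steps, and \<open>affine_offset\<close> is Q. Both are
  functions of the whole noise family, indexed as in the independence hypotheses:
  \<open>None\<close> for the initial value, \<open>Inl\<close> and \<open>Inr\<close> for the two
  noises of a step.\<close>

primrec affine_slope :: "(real \<Rightarrow> real \<Rightarrow> real) \<Rightarrow> nat \<Rightarrow> ((nat + nat) option \<Rightarrow> real) \<Rightarrow> real" where
  "affine_slope a 0 = (\<lambda>w. 1)"
| "affine_slope a (Suc n) = (\<lambda>w. a (w (Some (Inl n))) (w (Some (Inr n))) * affine_slope a n w)"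

primrec affine_offset :: "(real \<Rightarrow> real \<Rightarrow> real) \<Rightarrow> (real \<Rightarrow> real \<Rightarrow> real) \<Rightarrow> nat \<Rightarrow>
    ((nat + nat) option \<Rightarrow> real) \<Rightarrow> real" where
  "affine_offset a h 0 = (\<lambda>w. 0)"
| "affine_offset a h (Suc n) = (\<lambda>w. a (w (Some (Inl n))) (w (Some (Inr n))) * affine_offset a h n w
      + h (w (Some (Inl n))) (w (Some (Inr n))))"

text \<open>Leaving out \<open>None\<close> makes P and Q independent of \<open>Y0\<close>; leaving
  out the indices from n on makes them independent of the coefficients of step n.\<close>

definition noise_before :: "nat \<Rightarrow> (nat + nat) option set" where
  "noise_before n = Some ` (Inl ` {..<n} \<union> Inr ` {..<n})"

lemma noise_before_Suc:
  "noise_before n \<subseteq> noise_before (Suc n)" "Some (Inl n) \<in> noise_before (Suc n)" "Some (Inr n) \<in> noise_before (Suc n)"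
  by (auto simp: noise_before_def)

lemma cylinder_affine_slope:
  assumes "case_prod a \<in> borel_measurable (borel \<Otimes>\<^sub>M borel)"
  shows "cylinder (noise_before n) (affine_slope a n)"
proof (induction n)
  case (Suc n)
  then show ?case unfolding affine_slope.simps
    by (intro cylinder_mult cylinder_coordinates2 assms noise_before_Suc(2,3)
        cylinder_mono[OF Suc noise_before_Suc(1)])
qed (simp add: cylinder_const)

lemma cylinder_affine_offset:
  assumes "case_prod a \<in> borel_measurable (borel \<Otimes>\<^sub>M borel)" "case_prod h \<in> borel_measurable (borel \<Otimes>\<^sub>M borel)"
  shows "cylinder (noise_before n) (affine_offset a h n)"
proof (induction n)
  case (Suc n)
  then show ?case unfolding affine_offset.simps
    by (intro cylinder_add cylinder_mult cylinder_coordinates2 assms noise_before_Suc(2,3)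
        cylinder_mono[OF Suc noise_before_Suc(1)])
qed (simp add: cylinder_const)

text \<open>One pair of noises per step covers all schemes: (\<xi>, \<rho>) for every scheme except
  the second Strang one, which is driven by (\<phi>, \<psi>).\<close>

locale affine_noise = prob_space M for M :: "'a measure" +
  fixes Y0 :: "'a \<Rightarrow> real" and \<xi> \<eta> :: "nat \<Rightarrow> 'a \<Rightarrow> real"
  assumes square_integrable: "integrable M (\<lambda>\<omega>. (Y0 \<omega>)\<^sup>2)"
    and indep: "indep_vars (\<lambda>_. borel) (case_option Y0 (case_sum \<xi> \<eta>)) UNIV"
begin

abbreviation W :: "'a \<Rightarrow> (nat + nat) option \<Rightarrow> real" where
  "W \<omega> \<equiv> \<lambda>k. (case k of None \<Rightarrow> Y0 | Some k' \<Rightarrow> case_sum \<xi> \<eta> k') \<omega>"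

text \<open>Independence inside one step, for the two half-steps of the second Strang scheme and for
  the \<rho>-dependent weight of the log-ODE scheme.\<close>

lemma has_bochner_integral_noise_mult:
  fixes f g :: "real \<Rightarrow> real"
  assumes "f \<in> borel_measurable borel" "g \<in> borel_measurable borel"
    and "has_bochner_integral M (\<lambda>\<omega>. f (\<xi> j \<omega>)) x" "has_bochner_integral M (\<lambda>\<omega>. g (\<eta> j \<omega>)) y"
  shows "has_bochner_integral M (\<lambda>\<omega>. f (\<xi> j \<omega>) * g (\<eta> j \<omega>)) (x * y)"
proof -
  have "cylinder {Some (Inl j)} (\<lambda>w. f (w (Some (Inl j))))" "cylinder {Some (Inr j)} (\<lambda>w. g (w (Some (Inr j))))"
    using assms(1,2) by (auto intro: cylinder_coordinate)
  from indep_var_cylinder[OF prob_space_axioms indep _ this]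
  have "indep_var borel (\<lambda>\<omega>. f (\<xi> j \<omega>)) borel (\<lambda>\<omega>. g (\<eta> j \<omega>))" by simp
  from has_bochner_integral_indep_mult[OF prob_space_axioms this assms(3,4)] show ?thesis .
qed

text \<open>Independence between step n and the past; this is what makes the moment recursions
  linear.\<close>

lemma has_bochner_integral_step_mult:
  assumes "case_prod f \<in> borel_measurable (borel \<Otimes>\<^sub>M borel)" "cylinder (noise_before n) g"
    and "has_bochner_integral M (\<lambda>\<omega>. f (\<xi> n \<omega>) (\<eta> n \<omega>)) x" "has_bochner_integral M (\<lambda>\<omega>. g (W \<omega>)) y"
  shows "has_bochner_integral M (\<lambda>\<omega>. f (\<xi> n \<omega>) (\<eta> n \<omega>) * g (W \<omega>)) (x * y)"
proof -
  have "cylinder {Some (Inl n), Some (Inr n)} (\<lambda>w. f (w (Some (Inl n))) (w (Some (Inr n))))"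
    using assms(1) by (auto intro: cylinder_coordinates2)
  from indep_var_cylinder[OF prob_space_axioms indep _ this assms(2)]
  have "indep_var borel (\<lambda>\<omega>. f (\<xi> n \<omega>) (\<eta> n \<omega>)) borel (\<lambda>\<omega>. g (W \<omega>))"
    by (auto simp: noise_before_def)
  from has_bochner_integral_indep_mult[OF prob_space_axioms this assms(3,4)] show ?thesis .
qed

context
  fixes a h :: "real \<Rightarrow> real \<Rightarrow> real" and ma mh r s p :: real
  assumes a: "case_prod a \<in> borel_measurable (borel \<Otimes>\<^sub>M borel)"
    and h: "case_prod h \<in> borel_measurable (borel \<Otimes>\<^sub>M borel)"
    and Ea: "\<And>j. has_bochner_integral M (\<lambda>\<omega>. a (\<xi> j \<omega>) (\<eta> j \<omega>)) ma"
    and Eh: "\<And>j. has_bochner_integral M (\<lambda>\<omega>. h (\<xi> j \<omega>) (\<eta> j \<omega>)) mh"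
    and Eaa: "\<And>j. has_bochner_integral M (\<lambda>\<omega>. (a (\<xi> j \<omega>) (\<eta> j \<omega>))\<^sup>2) r"
    and Eah: "\<And>j. has_bochner_integral M (\<lambda>\<omega>. a (\<xi> j \<omega>) (\<eta> j \<omega>) * h (\<xi> j \<omega>) (\<eta> j \<omega>)) (ma * p)"
    and Ehh: "\<And>j. has_bochner_integral M (\<lambda>\<omega>. (h (\<xi> j \<omega>) (\<eta> j \<omega>))\<^sup>2) s"
begin

text \<open>From P' = A P and Q' = A Q + H one gets P' Q' = A^2 P Q + A H P and Q'^2 = A^2 Q^2 + 2 A
  H Q + H^2, where the step factors split off by independence. The mixed terms need E P and E Q,
  hence one induction for all five moments.\<close>

lemma affine_moments:
  "has_bochner_integral M (\<lambda>\<omega>. affine_slope a n (W \<omega>)) (ma ^ n)" (is "?P n")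
  "has_bochner_integral M (\<lambda>\<omega>. affine_offset a h n (W \<omega>)) (affine_mean ma mh n)" (is "?Q n")
  "has_bochner_integral M (\<lambda>\<omega>. (affine_slope a n (W \<omega>))\<^sup>2) (r ^ n)" (is "?PP n")
  "has_bochner_integral M (\<lambda>\<omega>. affine_slope a n (W \<omega>) * affine_offset a h n (W \<omega>)) (affine_cross ma r p n)" (is "?PQ n")
  "has_bochner_integral M (\<lambda>\<omega>. (affine_offset a h n (W \<omega>))\<^sup>2) (affine_square ma mh r p s n)" (is "?QQ n")
proof -
  have "?P n \<and> ?Q n \<and> ?PP n \<and> ?PQ n \<and> ?QQ n"
  proof (induction n)
    case 0
    have "has_bochner_integral M (\<lambda>\<omega>. 1 :: real) 1" by (simp add: has_bochner_integral_iff prob_space)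
    moreover have "has_bochner_integral M (\<lambda>\<omega>. 0 :: real) 0" by (rule has_bochner_integral_zero)
    ultimately show ?case by (simp add: affine_mean_def affine_cross_def affine_square_def)
  next
    case (Suc n)
    have aa: "(\<lambda>(x, y). (a x y)\<^sup>2) \<in> borel_measurable (borel \<Otimes>\<^sub>M borel)"
      and ah: "(\<lambda>(x, y). a x y * h x y) \<in> borel_measurable (borel \<Otimes>\<^sub>M borel)"
      using a h by (simp_all add: case_prod_unfold)
    note cP = cylinder_affine_slope[OF a, of n] and cQ = cylinder_affine_offset[OF a h, of n]
    have cPP: "cylinder (noise_before n) (\<lambda>w. (affine_slope a n w)\<^sup>2)"
      and cPQ: "cylinder (noise_before n) (\<lambda>w. affine_slope a n w * affine_offset a h n w)"
      and cQQ: "cylinder (noise_before n) (\<lambda>w. (affine_offset a h n w)\<^sup>2)"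
      using cP cQ by (auto simp: power2_eq_square intro: cylinder_mult)
    from Suc have IH: "?P n" "?Q n" "?PP n" "?PQ n" "?QQ n" by auto
    note m = has_bochner_integral_step_mult
    have "?P (Suc n)"
      using m[OF a cP Ea IH(1)] by simp
    moreover have "?Q (Suc n)"
      unfolding affine_mean_Suc using has_bochner_integral_add[OF m[OF a cQ Ea IH(2)] Eh[of n]] by simp
    moreover have "?PP (Suc n)"
      using m[OF aa cPP Eaa IH(3)] by (simp add: power_mult_distrib)
    moreover have "?PQ (Suc n)"
      unfolding affine_cross_Suc
      using has_bochner_integral_add[OF m[OF aa cPQ Eaa IH(4)] m[OF ah cP Eah IH(1)]]
      by (simp add: power2_eq_square algebra_simps)
    moreover have "?QQ (Suc n)"
      unfolding affine_square_Suc
      using has_bochner_integral_add[OF has_bochner_integral_add[OF m[OF aa cQQ Eaa IH(5)]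
            has_bochner_integral_mult_right[OF m[OF ah cQ Eah IH(2)], of 2]] Ehh[of n]]
      by (simp add: power2_eq_square algebra_simps)
    ultimately show ?case by blast
  qed
  then show "?P n" "?Q n" "?PP n" "?PQ n" "?QQ n" by auto
qed

text \<open>The result stays in terms of \<open>affine_mean\<close>, \<open>affine_cross\<close> and
  \<open>affine_square\<close>, because the first Lie-Trotter scheme sums them over other index
  ranges than the remaining schemes.\<close>

theorem affine_recursion_cond_moments:
  fixes Y :: "nat \<Rightarrow> 'a \<Rightarrow> real" and b c :: real
  assumes Y_0: "Y 0 = Y0"
    and Y_Suc: "\<And>n \<omega>. Y (Suc n) \<omega> + b = a (\<xi> n \<omega>) (\<eta> n \<omega>) * (Y n \<omega> + b) + c * h (\<xi> n \<omega>) (\<eta> n \<omega>)"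
  shows "AE \<omega> in M. real_cond_exp M (sigma_gen M Y0) (Y n) \<omega> = (Y0 \<omega> + b) * ma ^ n + c * affine_mean ma mh n - b"
    and "AE \<omega> in M. cond_variance M (sigma_gen M Y0) (Y n) \<omega> =
      (Y0 \<omega> + b)\<^sup>2 * (r ^ n - ma ^ (2 * n))
      + 2 * c * (Y0 \<omega> + b) * (affine_cross ma r p n - ma ^ n * affine_mean ma mh n)
      + c\<^sup>2 * (affine_square ma mh r p s n - (affine_mean ma mh n)\<^sup>2)"
proof -
  let ?S = "noise_before n"
  let ?V = "\<lambda>\<omega>. restrict (W \<omega>) ?S"
  let ?P = "affine_slope a n" and ?Q = "affine_offset a h n"
  have ind: "indep_of M Y0 (\<Pi>\<^sub>M k\<in>?S. borel) ?V"
    using indep_of_coordinates[OF prob_space_axioms indep, of None ?S] by (simp add: noise_before_def)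
  have P: "?P \<in> borel_measurable (\<Pi>\<^sub>M k\<in>?S. borel)" "\<And>w. ?P (restrict w ?S) = ?P w"
    using cylinder_affine_slope[OF a, of n] by (auto simp: cylinder_def)
  have Q: "?Q \<in> borel_measurable (\<Pi>\<^sub>M k\<in>?S. borel)" "\<And>w. ?Q (restrict w ?S) = ?Q w"
    using cylinder_affine_offset[OF a h, of n] by (auto simp: cylinder_def)
  have cQ: "(\<lambda>w. c * ?Q w) \<in> borel_measurable (\<Pi>\<^sub>M k\<in>?S. borel)" using Q(1) by measurable
  have "Y n \<omega> + b = affine_slope a n (W \<omega>) * (Y0 \<omega> + b) + c * affine_offset a h n (W \<omega>)" for \<omega>
    by (induction n) (simp add: Y_0, simp add: Y_Suc distrib_left mult.assoc mult.left_commute)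
  then have Y: "Y n \<omega> = ?P (?V \<omega>) * (Y0 \<omega> + b) + c * ?Q (?V \<omega>) + - b" for \<omega>
    unfolding P(2) Q(2) by (metis add.commute add_diff_cancel_left' diff_conv_add_uminus)
  have mom: "has_bochner_integral M (\<lambda>\<omega>. ?P (?V \<omega>)) (ma ^ n)"
    "has_bochner_integral M (\<lambda>\<omega>. ?Q (?V \<omega>)) (affine_mean ma mh n)"
    "has_bochner_integral M (\<lambda>\<omega>. (?P (?V \<omega>))\<^sup>2) (r ^ n)"
    "has_bochner_integral M (\<lambda>\<omega>. ?P (?V \<omega>) * ?Q (?V \<omega>)) (affine_cross ma r p n)"
    "has_bochner_integral M (\<lambda>\<omega>. (?Q (?V \<omega>))\<^sup>2) (affine_square ma mh r p s n)"
    unfolding P(2) Q(2) by (rule affine_moments)+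
  have mq: "has_bochner_integral M (\<lambda>\<omega>. c * ?Q (?V \<omega>)) (c * affine_mean ma mh n)"
    by (rule has_bochner_integral_mult_right[OF mom(2)])
  have mpq: "has_bochner_integral M (\<lambda>\<omega>. ?P (?V \<omega>) * (c * ?Q (?V \<omega>))) (c * affine_cross ma r p n)"
    using has_bochner_integral_mult_right[OF mom(4), of c] by (simp add: mult_ac)
  have mqq: "has_bochner_integral M (\<lambda>\<omega>. (c * ?Q (?V \<omega>))\<^sup>2) (c\<^sup>2 * affine_square ma mh r p s n)"
    using has_bochner_integral_mult_right[OF mom(5), of "c\<^sup>2"] by (simp add: power_mult_distrib)
  show "AE \<omega> in M. real_cond_exp M (sigma_gen M Y0) (Y n) \<omega> = (Y0 \<omega> + b) * ma ^ n + c * affine_mean ma mh n - b"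
    using real_cond_exp_affine[where p = "?P" and q = "\<lambda>w. c * ?Q w" and V = "?V" and Y = "Y n" and b = b and d = "- b",
        OF prob_space_axioms ind P(1) cQ square_integrable mom(1) mq Y] by simp
  show "AE \<omega> in M. cond_variance M (sigma_gen M Y0) (Y n) \<omega> =
      (Y0 \<omega> + b)\<^sup>2 * (r ^ n - ma ^ (2 * n))
      + 2 * c * (Y0 \<omega> + b) * (affine_cross ma r p n - ma ^ n * affine_mean ma mh n)
      + c\<^sup>2 * (affine_square ma mh r p s n - (affine_mean ma mh n)\<^sup>2)"
    using cond_variance_affine[where p = "?P" and q = "\<lambda>w. c * ?Q w" and V = "?V" and Y = "Y n" and b = b and d = "- b",
        OF prob_space_axioms ind P(1) cQ square_integrable mom(1) mq mom(3) mpq mqq Y]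
  proof eventually_elim
    case (elim \<omega>)
    show ?case unfolding elim
      by (simp add: power_mult power_mult_distrib power2_eq_square algebra_simps flip: power_mult_distrib)
  qed
qed

end

end

section \<open>The schemes\<close>

text \<open>The conclusion of the final theorem with the solution abstracted to \<open>Y\<close>, so
  that the schemes can be treated one by one.\<close>

definition scheme_formula :: "'a measure \<Rightarrow> scheme \<Rightarrow> real \<Rightarrow> real \<Rightarrow> real \<Rightarrow> real \<Rightarrow> ('a \<Rightarrow> real) \<Rightarrow>
    (nat \<Rightarrow> 'a \<Rightarrow> real) \<Rightarrow> nat \<Rightarrow> bool" where
  "scheme_formula M s \<tau> \<sigma> \<mu> \<Delta> Y0 Y i \<longleftrightarrow> (let
             \<mu>\<^sub>x = coef_mu_x s \<tau> \<sigma> \<Delta>;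
             \<mu>\<^sub>h = coef_mu_h s \<tau> \<sigma> \<Delta>;
             r = coef_r s \<tau> \<sigma> \<Delta>;
             r\<^sub>h = coef_r_h s \<tau> \<sigma> \<Delta>;
             p = coef_p s \<tau> \<sigma> \<Delta>;
             c\<^sub>1 = \<mu> * \<Delta>;
             c\<^sub>2 = coef_c2 s \<mu> \<Delta>;
             I = coef_I s i;
             Z\<^sub>0 = (\<lambda>\<omega>. coef_Z0 s \<mu> \<Delta> (Y0 \<omega>));
             W\<^sub>0 = coef_W0 s
         in (AE \<omega> in M. real_cond_exp M (sigma_gen M Y0) (Y i) \<omega> =
               Z\<^sub>0 \<omega> * \<mu>\<^sub>x ^ i + c\<^sub>1 * \<mu>\<^sub>h * (\<Sum>k = 1..I. \<mu>\<^sub>x ^ k) + c\<^sub>1 * W\<^sub>0 * \<mu>\<^sub>h + c\<^sub>2)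
          \<and> (AE \<omega> in M. cond_variance M (sigma_gen M Y0) (Y i) \<omega> =
               (Z\<^sub>0 \<omega>)\<^sup>2 * (r ^ i - \<mu>\<^sub>x ^ (2 * i))
               + 2 * c\<^sub>1 * Z\<^sub>0 \<omega> * (\<Sum>k = 0..I. r ^ k * \<mu>\<^sub>x ^ (i - k) * p - \<mu>\<^sub>x ^ (i + k) * \<mu>\<^sub>h)
               + c\<^sub>1\<^sup>2 * ((\<Sum>k = 0..I. r ^ k * r\<^sub>h - \<mu>\<^sub>x ^ (2 * k) * \<mu>\<^sub>h\<^sup>2)
                   + 2 * (\<Sum>l = 1..I. \<Sum>k = 0..l - 1.
                        \<mu>\<^sub>h * r ^ k * \<mu>\<^sub>x ^ (l - k) * p - \<mu>\<^sub>x ^ (l + k) * \<mu>\<^sub>h\<^sup>2))))"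

text \<open>A scheme is thereby reduced to five step moments and one affine identity. Reading b off
  as the value of Z0 at 0 gives Z0 = Y0 + b uniformly.\<close>

lemma (in affine_noise) scheme_formula_affine:
  fixes a h :: "real \<Rightarrow> real \<Rightarrow> real" and s :: scheme and \<tau> \<sigma> \<mu> \<Delta> :: real
  defines "b \<equiv> coef_Z0 s \<mu> \<Delta> 0"
  assumes s: "s \<noteq> Lie_Trotter1" and n: "n \<ge> 1"
    and "case_prod a \<in> borel_measurable (borel \<Otimes>\<^sub>M borel)" "case_prod h \<in> borel_measurable (borel \<Otimes>\<^sub>M borel)"
    and "\<And>j. has_bochner_integral M (\<lambda>\<omega>. a (\<xi> j \<omega>) (\<eta> j \<omega>)) (coef_mu_x s \<tau> \<sigma> \<Delta>)"
    and "\<And>j. has_bochner_integral M (\<lambda>\<omega>. h (\<xi> j \<omega>) (\<eta> j \<omega>)) (coef_mu_h s \<tau> \<sigma> \<Delta>)"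
    and "\<And>j. has_bochner_integral M (\<lambda>\<omega>. (a (\<xi> j \<omega>) (\<eta> j \<omega>))\<^sup>2) (coef_r s \<tau> \<sigma> \<Delta>)"
    and "\<And>j. has_bochner_integral M (\<lambda>\<omega>. a (\<xi> j \<omega>) (\<eta> j \<omega>) * h (\<xi> j \<omega>) (\<eta> j \<omega>))
      (coef_mu_x s \<tau> \<sigma> \<Delta> * coef_p s \<tau> \<sigma> \<Delta>)"
    and "\<And>j. has_bochner_integral M (\<lambda>\<omega>. (h (\<xi> j \<omega>) (\<eta> j \<omega>))\<^sup>2) (coef_r_h s \<tau> \<sigma> \<Delta>)"
    and "Y 0 = Y0"
    and "\<And>j \<omega>. Y (Suc j) \<omega> + b = a (\<xi> j \<omega>) (\<eta> j \<omega>) * (Y j \<omega> + b) + \<mu> * \<Delta> * h (\<xi> j \<omega>) (\<eta> j \<omega>)"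
  shows "scheme_formula M s \<tau> \<sigma> \<mu> \<Delta> Y0 Y n"
proof -
  note mom = affine_recursion_cond_moments[OF assms(4-12)]
  have Z0: "y + b = coef_Z0 s \<mu> \<Delta> y" for y
    unfolding b_def by (cases s) (simp_all add: coef_Z0_def)
  have I: "coef_I s n = n - 1" using s by (cases s) (simp_all add: coef_I_def)
  \<comment> \<open>The summand of index 0 and the shift - b are accounted for here: either W0 = 1
    with b = 0 and c2 = 0, or W0 = 0 with \<open>\<mu>\<^sub>h = 1\<close> and c2 = c1 - b.\<close>
  have W0: "x + \<mu> * \<Delta> * (coef_mu_h s \<tau> \<sigma> \<Delta> * S + coef_mu_h s \<tau> \<sigma> \<Delta>) - b =
      x + \<mu> * \<Delta> * coef_mu_h s \<tau> \<sigma> \<Delta> * S + \<mu> * \<Delta> * coef_W0 s * coef_mu_h s \<tau> \<sigma> \<Delta> + coef_c2 s \<mu> \<Delta>" for x S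
    unfolding b_def using s
    by (cases s) (simp_all add: coef_Z0_def coef_W0_def coef_c2_def coef_mu_h_def distrib_left)
  have "AE \<omega> in M. real_cond_exp M (sigma_gen M Y0) (Y n) \<omega> =
      coef_Z0 s \<mu> \<Delta> (Y0 \<omega>) * coef_mu_x s \<tau> \<sigma> \<Delta> ^ n
      + \<mu> * \<Delta> * coef_mu_h s \<tau> \<sigma> \<Delta> * (\<Sum>k = 1..n - 1. coef_mu_x s \<tau> \<sigma> \<Delta> ^ k)
      + \<mu> * \<Delta> * coef_W0 s * coef_mu_h s \<tau> \<sigma> \<Delta> + coef_c2 s \<mu> \<Delta>"
    using mom(1)[of n] unfolding affine_mean_closed[OF n] W0 Z0 .
  moreover note mom(2)[of n, unfolded affine_covariance_closed[OF n] affine_variance_closed[OF n] Z0]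
  ultimately show ?thesis unfolding scheme_formula_def Let_def I by (intro conjI)
qed

theorem corollary1:
  fixes M :: "'a measure"
    and \<tau> \<sigma> \<mu> \<Delta> :: real
    and Y0 :: "'a \<Rightarrow> real"
    and \<xi> \<rho> \<phi> \<psi> :: "nat \<Rightarrow> 'a \<Rightarrow> real"
    and s :: scheme
    and i :: nat
  assumes "prob_space M"
    and "\<tau> > 0" and "\<sigma> > 0" and "\<Delta> > 0"
    and "Y0 \<in> borel_measurable M"
    and "AE \<omega> in M. Y0 \<omega> \<ge> 0"
    and "integrable M (\<lambda>\<omega>. (Y0 \<omega>)\<^sup>2)"
    and "\<And>j. distributed M lborel (\<xi> j) (normal_density 0 (sqrt \<Delta>))"
    and "\<And>j. distributed M lborel (\<rho> j) (normal_density 0 (sqrt (\<Delta> / 12)))"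
    and "\<And>j. distributed M lborel (\<phi> j) (normal_density 0 (sqrt (\<Delta> / 2)))"
    and "\<And>j. distributed M lborel (\<psi> j) (normal_density 0 (sqrt (\<Delta> / 2)))"
    and "prob_space.indep_vars M (\<lambda>_. borel) (case_option Y0 (case_sum \<xi> \<rho>)) UNIV"
    and "prob_space.indep_vars M (\<lambda>_. borel) (case_option Y0 (case_sum \<phi> \<psi>)) UNIV"
    and "i \<ge> 1"
  shows "let Y = scheme_sol s \<tau> \<sigma> \<mu> \<Delta> Y0 \<xi> \<rho> \<phi> \<psi>;
             \<mu>\<^sub>x = coef_mu_x s \<tau> \<sigma> \<Delta>;
             \<mu>\<^sub>h = coef_mu_h s \<tau> \<sigma> \<Delta>;
             r = coef_r s \<tau> \<sigma> \<Delta>;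
             r\<^sub>h = coef_r_h s \<tau> \<sigma> \<Delta>;
             p = coef_p s \<tau> \<sigma> \<Delta>;
             c\<^sub>1 = \<mu> * \<Delta>;
             c\<^sub>2 = coef_c2 s \<mu> \<Delta>;
             I = coef_I s i;
             Z\<^sub>0 = (\<lambda>\<omega>. coef_Z0 s \<mu> \<Delta> (Y0 \<omega>));
             W\<^sub>0 = coef_W0 s
         in (AE \<omega> in M. real_cond_exp M (sigma_gen M Y0) (Y i) \<omega> =
               Z\<^sub>0 \<omega> * \<mu>\<^sub>x ^ i + c\<^sub>1 * \<mu>\<^sub>h * (\<Sum>k = 1..I. \<mu>\<^sub>x ^ k) + c\<^sub>1 * W\<^sub>0 * \<mu>\<^sub>h + c\<^sub>2)
          \<and> (AE \<omega> in M. cond_variance M (sigma_gen M Y0) (Y i) \<omega> =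
               (Z\<^sub>0 \<omega>)\<^sup>2 * (r ^ i - \<mu>\<^sub>x ^ (2 * i))
               + 2 * c\<^sub>1 * Z\<^sub>0 \<omega> * (\<Sum>k = 0..I. r ^ k * \<mu>\<^sub>x ^ (i - k) * p - \<mu>\<^sub>x ^ (i + k) * \<mu>\<^sub>h)
               + c\<^sub>1\<^sup>2 * ((\<Sum>k = 0..I. r ^ k * r\<^sub>h - \<mu>\<^sub>x ^ (2 * k) * \<mu>\<^sub>h\<^sup>2)
                   + 2 * (\<Sum>l = 1..I. \<Sum>k = 0..l - 1.
                        \<mu>\<^sub>h * r ^ k * \<mu>\<^sub>x ^ (l - k) * p - \<mu>\<^sub>x ^ (l + k) * \<mu>\<^sub>h\<^sup>2)))"
proof -
  interpret prob_space M by fact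
  note pos = \<open>\<tau> > 0\<close> \<open>\<sigma> > 0\<close> \<open>\<Delta> > 0\<close>
  interpret xr: affine_noise M Y0 \<xi> \<rho>
    using assms(7,12) by unfold_locales
  interpret fp: affine_noise M Y0 \<phi> \<psi>
    using assms(7,13) by unfold_locales
  let ?Y = "scheme_sol s \<tau> \<sigma> \<mu> \<Delta> Y0 \<xi> \<rho> \<phi> \<psi>"
  let ?X = "igbm_X \<tau> \<sigma> \<Delta>" and ?\<alpha> = "igbm_alpha \<tau> \<sigma> \<Delta>"
  note sol = scheme_sol.simps scheme_step.simps
  have one: "has_bochner_integral M (\<lambda>\<omega>. 1 :: real) 1"
    by (simp add: has_bochner_integral_iff prob_space)
  have xi: "has_bochner_integral M (\<lambda>\<omega>. g (\<xi> j \<omega>)) e"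
    if "has_bochner_integral lborel (\<lambda>x. normal_density 0 (sqrt \<Delta>) x * g x) e" "g \<in> borel_measurable borel" for g e j
    by (rule distributed_has_bochner_integral[OF assms(8) _ that(2,1)]) simp
  have rho: "has_bochner_integral M (\<lambda>\<omega>. g (\<rho> j \<omega>)) e"
    if "has_bochner_integral lborel (\<lambda>x. normal_density 0 (sqrt (\<Delta> / 12)) x * g x) e" "g \<in> borel_measurable borel" for g e j
    by (rule distributed_has_bochner_integral[OF assms(9) _ that(2,1)]) simp
  have phi: "has_bochner_integral M (\<lambda>\<omega>. g (\<phi> j \<omega>)) e"
    if "has_bochner_integral lborel (\<lambda>x. normal_density 0 (sqrt (\<Delta> / 2)) x * g x) e" "g \<in> borel_measurable borel" for g e j
    by (rule distributed_has_bochner_integral[OF assms(10) _ that(2,1)]) simp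
  have psi: "has_bochner_integral M (\<lambda>\<omega>. g (\<psi> j \<omega>)) e"
    if "has_bochner_integral lborel (\<lambda>x. normal_density 0 (sqrt (\<Delta> / 2)) x * g x) e" "g \<in> borel_measurable borel" for g e j
    by (rule distributed_has_bochner_integral[OF assms(11) _ that(2,1)]) simp
  have quartic: "has_bochner_integral M (\<lambda>\<omega>. a0 + a1 * \<xi> j \<omega> + a2 * (\<xi> j \<omega>)\<^sup>2 + a3 * (\<xi> j \<omega>) ^ 3 + a4 * (\<xi> j \<omega>) ^ 4)
      (a0 + a2 * \<Delta> + 3 * a4 * \<Delta>\<^sup>2)" for a0 a1 a2 a3 a4 j
  proof -
    have "sqrt \<Delta> ^ 4 = \<Delta>\<^sup>2" using pos by (metis numeral_Bit0 mult_2 power_mult real_sqrt_pow2 less_imp_le power2_eq_square power_add)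
    then show ?thesis
      using xi[OF has_bochner_integral_normal_quartic[of "sqrt \<Delta>" a0 a1 a2 a3 a4], of j] pos by simp
  qed
  note X = xi[OF has_bochner_integral_igbm_X[OF pos] igbm_X_measurable]
  have XX: "has_bochner_integral M (\<lambda>\<omega>. (?X (\<xi> j \<omega>))\<^sup>2) (exp (\<sigma>\<^sup>2 * \<Delta> - 2 * \<Delta> / \<tau>))" for j
    by (rule xi[OF has_bochner_integral_igbm_X_square[OF pos]]) measurable
  note al = xi[OF has_bochner_integral_igbm_alpha[OF pos] igbm_alpha_measurable]
  have Xal: "has_bochner_integral M (\<lambda>\<omega>. ?X (\<xi> j \<omega>) * ?\<alpha> (\<xi> j \<omega>)) (exp (- \<Delta> / \<tau>) * igbm_L_tilde \<tau> \<sigma> \<Delta>)" for j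
    by (rule xi[OF has_bochner_integral_igbm_X_alpha[OF pos]]) measurable
  have alal: "has_bochner_integral M (\<lambda>\<omega>. (?\<alpha> (\<xi> j \<omega>))\<^sup>2) (igbm_L_bar \<tau> \<sigma> \<Delta>)" for j
    by (rule xi[OF has_bochner_integral_igbm_alpha_square[OF pos]]) measurable
  have m1: "(\<lambda>(x, q :: real). g x) \<in> borel_measurable (borel \<Otimes>\<^sub>M borel)"
    if [measurable]: "g \<in> borel_measurable borel" for g :: "real \<Rightarrow> real" by measurable
  have m2: "(\<lambda>(x :: real, q). g q) \<in> borel_measurable (borel \<Otimes>\<^sub>M borel)"
    if [measurable]: "g \<in> borel_measurable borel" for g :: "real \<Rightarrow> real" by measurable
  have mult2: "(\<lambda>(x, q). f x * g q) \<in> borel_measurable (borel \<Otimes>\<^sub>M borel)"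
    if [measurable]: "f \<in> borel_measurable borel" "g \<in> borel_measurable borel" for f g :: "real \<Rightarrow> real" by measurable
  note meas = igbm_X_measurable igbm_alpha_measurable
  note i1 = \<open>i \<ge> 1\<close>[unfolded One_nat_def]
  note coefs = coef_mu_x_def coef_mu_h_def coef_r_def coef_r_h_def coef_p_def coef_Z0_def
  have "scheme_formula M s \<tau> \<sigma> \<mu> \<Delta> Y0 ?Y i"
  proof (cases s)
    case Euler_Maruyama
    let ?A = "1 - \<Delta> / \<tau>"
    show ?thesis
    proof (rule xr.scheme_formula_affine[where a = "\<lambda>x q. ?A + \<sigma> * x" and h = "\<lambda>x q. 1"])
      show "has_bochner_integral M (\<lambda>\<omega>. ?A + \<sigma> * \<xi> j \<omega>) (coef_mu_x s \<tau> \<sigma> \<Delta>)" for j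
        using quartic[of ?A \<sigma> j 0 0 0] by (simp add: Euler_Maruyama coefs)
      then show "has_bochner_integral M (\<lambda>\<omega>. (?A + \<sigma> * \<xi> j \<omega>) * 1) (coef_mu_x s \<tau> \<sigma> \<Delta> * coef_p s \<tau> \<sigma> \<Delta>)" for j
        by (simp add: Euler_Maruyama coefs)
      show "has_bochner_integral M (\<lambda>\<omega>. (?A + \<sigma> * \<xi> j \<omega>)\<^sup>2) (coef_r s \<tau> \<sigma> \<Delta>)" for j
      proof -
        have sq: "(B + \<sigma> * x)\<^sup>2 = B\<^sup>2 + 2 * B * \<sigma> * x + \<sigma>\<^sup>2 * x\<^sup>2 + 0 * x ^ 3 + 0 * x ^ 4" for B x :: real
          by (simp add: power2_eq_square algebra_simps)
        show ?thesis
          using quartic[of "?A\<^sup>2" "2 * ?A * \<sigma>" j "\<sigma>\<^sup>2" 0 0]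
          unfolding sq by (simp add: Euler_Maruyama coefs add.commute)
      qed
      show "?Y (Suc j) \<omega> + coef_Z0 s \<mu> \<Delta> 0 = (?A + \<sigma> * \<xi> j \<omega>) * (?Y j \<omega> + coef_Z0 s \<mu> \<Delta> 0) + \<mu> * \<Delta> * 1" for j \<omega>
        by (simp add: Euler_Maruyama coefs sol algebra_simps)
      show "(\<lambda>(x :: real, q :: real). 1 :: real) \<in> borel_measurable (borel \<Otimes>\<^sub>M borel)" by simp
      show "(\<lambda>(x :: real, q :: real). ?A + \<sigma> * x) \<in> borel_measurable (borel \<Otimes>\<^sub>M borel)" by (rule m1) measurable
    qed (simp_all add: Euler_Maruyama coefs one i1)
  next
    case Milstein
    let ?A = "1 - \<Delta> / \<tau>"
    \<comment> \<open>Constant term of the Milstein factor sorted by powers of the increment; the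
      centring of \<xi>^2 lowers it by \<sigma>^2 \<Delta> / 2, and the mean of the quadratic term
      restores 1 - \<Delta> / \<tau>.\<close>
    define u where "u = ?A - \<sigma>\<^sup>2 * \<Delta> / 2"
    define a where "a x = u + \<sigma> * x + \<sigma>\<^sup>2 / 2 * x\<^sup>2" for x
    show ?thesis
    proof (rule xr.scheme_formula_affine[where a = "\<lambda>x q. a x" and h = "\<lambda>x q. 1"])
      show "has_bochner_integral M (\<lambda>\<omega>. a (\<xi> j \<omega>)) (coef_mu_x s \<tau> \<sigma> \<Delta>)" for j
        using quartic[of u \<sigma> j "\<sigma>\<^sup>2 / 2" 0 0] by (simp add: Milstein coefs a_def u_def)
      then show "has_bochner_integral M (\<lambda>\<omega>. a (\<xi> j \<omega>) * 1) (coef_mu_x s \<tau> \<sigma> \<Delta> * coef_p s \<tau> \<sigma> \<Delta>)" for j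
        by (simp add: Milstein coefs)
      show "has_bochner_integral M (\<lambda>\<omega>. (a (\<xi> j \<omega>))\<^sup>2) (coef_r s \<tau> \<sigma> \<Delta>)" for j
      proof -
        have sq: "(a x)\<^sup>2 = u\<^sup>2 + 2 * u * \<sigma> * x + (\<sigma>\<^sup>2 + u * \<sigma>\<^sup>2) * x\<^sup>2 + \<sigma> ^ 3 * x ^ 3 + \<sigma> ^ 4 / 4 * x ^ 4" for x
          unfolding a_def by (simp add: power2_eq_square power3_eq_cube power4_eq_xxxx algebra_simps)
        \<comment> \<open>The last summand on the right is the variance of the Milstein correction
          \<sigma>^2 (\<xi>^2 - \<Delta>) / 2.\<close>
        have "u\<^sup>2 + (\<sigma>\<^sup>2 + u * \<sigma>\<^sup>2) * \<Delta> + 3 * (\<sigma> ^ 4 / 4) * \<Delta>\<^sup>2 = \<sigma>\<^sup>2 * \<Delta> + ?A\<^sup>2 + (\<sigma>\<^sup>2 * \<Delta>)\<^sup>2 / 2"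
        proof -
          have A: "?A = u + \<sigma>\<^sup>2 * \<Delta> / 2" by (simp add: u_def)
          show ?thesis unfolding A by (simp add: power2_eq_square power4_eq_xxxx field_simps)
        qed
        then show ?thesis
          using quartic[of "u\<^sup>2" "2 * u * \<sigma>" j "\<sigma>\<^sup>2 + u * \<sigma>\<^sup>2" "\<sigma> ^ 3" "\<sigma> ^ 4 / 4"] unfolding sq
          by (simp only: Milstein coefs scheme.case)
      qed
      show "?Y (Suc j) \<omega> + coef_Z0 s \<mu> \<Delta> 0 = a (\<xi> j \<omega>) * (?Y j \<omega> + coef_Z0 s \<mu> \<Delta> 0) + \<mu> * \<Delta> * 1" for j \<omega>
        by (simp add: Milstein coefs sol a_def u_def power2_eq_square algebra_simps)
      show "(\<lambda>(x :: real, q :: real). a x) \<in> borel_measurable (borel \<Otimes>\<^sub>M borel)"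
        unfolding a_def[abs_def] by measurable
      show "(\<lambda>(x :: real, q :: real). 1 :: real) \<in> borel_measurable (borel \<Otimes>\<^sub>M borel)" by simp
    qed (simp_all add: Milstein coefs one i1)
  next
    case Lie_Trotter1
    let ?m = "exp (- \<Delta> / \<tau>)" and ?r = "exp (\<sigma>\<^sup>2 * \<Delta> - 2 * \<Delta> / \<tau>)"
    have Xm: "(\<lambda>(x, q :: real). ?X x) \<in> borel_measurable (borel \<Otimes>\<^sub>M borel)" by (rule m1[OF meas(1)])
    \<comment> \<open>With H = X the abstract p is r / m, not the value 1 of \<open>coef_p\<close>;
      shifting the indices absorbs the difference.\<close>
    have XX': "has_bochner_integral M (\<lambda>\<omega>. ?X (\<xi> j \<omega>) * ?X (\<xi> j \<omega>)) (?m * (?r / ?m))" for j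
      using XX[of j] by (simp add: power2_eq_square)
    have step: "?Y (Suc j) \<omega> + 0 = ?X (\<xi> j \<omega>) * (?Y j \<omega> + 0) + \<mu> * \<Delta> * ?X (\<xi> j \<omega>)" for j \<omega>
      by (simp add: Lie_Trotter1 sol algebra_simps)
    note mom = xr.affine_recursion_cond_moments[where a = "\<lambda>x q. ?X x" and h = "\<lambda>x q. ?X x" and Y = ?Y,
        OF Xm Xm X X XX XX' XX _ step, of i]
    show ?thesis
      using mom(1)[unfolded affine_mean_shift]
        mom(2)[unfolded affine_covariance_shift[OF exp_not_eq_zero] affine_variance_shift[OF exp_not_eq_zero]]
      by (simp add: scheme_formula_def Let_def Lie_Trotter1 coefs coef_c2_def coef_I_def coef_W0_def)
  next
    case Lie_Trotter2
    show ?thesis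
    proof (rule xr.scheme_formula_affine[where a = "\<lambda>x q. ?X x" and h = "\<lambda>x q. 1"])
      show "?Y (Suc j) \<omega> + coef_Z0 s \<mu> \<Delta> 0 = ?X (\<xi> j \<omega>) * (?Y j \<omega> + coef_Z0 s \<mu> \<Delta> 0) + \<mu> * \<Delta> * 1" for j \<omega>
        by (simp add: Lie_Trotter2 coefs sol)
      show "(\<lambda>(x :: real, q :: real). 1 :: real) \<in> borel_measurable (borel \<Otimes>\<^sub>M borel)" by simp
      show "(\<lambda>(x :: real, q :: real). ?X x) \<in> borel_measurable (borel \<Otimes>\<^sub>M borel)" by (rule m1[OF meas(1)])
      show "has_bochner_integral M (\<lambda>\<omega>. ?X (\<xi> j \<omega>)) (coef_mu_x s \<tau> \<sigma> \<Delta>)" for j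
        using X[of j] unfolding coef_mu_x_def Lie_Trotter2 scheme.case .
      show "has_bochner_integral M (\<lambda>\<omega>. (?X (\<xi> j \<omega>))\<^sup>2) (coef_r s \<tau> \<sigma> \<Delta>)" for j
        using XX[of j] unfolding coef_r_def Lie_Trotter2 scheme.case .
      show "has_bochner_integral M (\<lambda>\<omega>. ?X (\<xi> j \<omega>) * 1) (coef_mu_x s \<tau> \<sigma> \<Delta> * coef_p s \<tau> \<sigma> \<Delta>)" for j
        using X[of j] unfolding coef_mu_x_def coef_p_def Lie_Trotter2 scheme.case mult_1_right .
    qed (simp_all add: Lie_Trotter2 coefs one i1)
  next
    case Strang1
    show ?thesis
    proof (rule xr.scheme_formula_affine[where a = "\<lambda>x q. ?X x" and h = "\<lambda>x q. 1"])
      \<comment> \<open>Here b = \<mu> \<Delta> / 2: the two halves of the inhomogeneity combine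
        into \<mu> \<Delta>.\<close>
      show "?Y (Suc j) \<omega> + coef_Z0 s \<mu> \<Delta> 0 = ?X (\<xi> j \<omega>) * (?Y j \<omega> + coef_Z0 s \<mu> \<Delta> 0) + \<mu> * \<Delta> * 1" for j \<omega>
        by (simp add: Strang1 coefs sol)
      show "(\<lambda>(x :: real, q :: real). 1 :: real) \<in> borel_measurable (borel \<Otimes>\<^sub>M borel)" by simp
      show "(\<lambda>(x :: real, q :: real). ?X x) \<in> borel_measurable (borel \<Otimes>\<^sub>M borel)" by (rule m1[OF meas(1)])
      show "has_bochner_integral M (\<lambda>\<omega>. ?X (\<xi> j \<omega>)) (coef_mu_x s \<tau> \<sigma> \<Delta>)" for j
        using X[of j] unfolding coef_mu_x_def Strang1 scheme.case .
      show "has_bochner_integral M (\<lambda>\<omega>. (?X (\<xi> j \<omega>))\<^sup>2) (coef_r s \<tau> \<sigma> \<Delta>)" for j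
        using XX[of j] unfolding coef_r_def Strang1 scheme.case .
      show "has_bochner_integral M (\<lambda>\<omega>. ?X (\<xi> j \<omega>) * 1) (coef_mu_x s \<tau> \<sigma> \<Delta> * coef_p s \<tau> \<sigma> \<Delta>)" for j
        using X[of j] unfolding coef_mu_x_def coef_p_def Strang1 scheme.case mult_1_right .
    qed (simp_all add: Strang1 coefs one i1)
  next
    case Strang2
    \<comment> \<open>Half-step factor: A = e(\<phi>) e(\<psi>) and H = e(\<psi>). Its first two
      moments m and r are the square roots of the full-step ones, and A H = e(\<phi>) e(\<psi>)^2
      has mean m r.\<close>
    define e where "e x = exp (- igbm_a \<tau> \<sigma> * \<Delta> / 2 + \<sigma> * x)" for x
    define m r where "m = exp (- \<Delta> / \<tau> / 2)" and "r = exp ((\<sigma>\<^sup>2 * \<Delta> - 2 * \<Delta> / \<tau>) / 2)"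
    have em [measurable]: "e \<in> borel_measurable borel" "(\<lambda>x. (e x)\<^sup>2) \<in> borel_measurable borel"
      unfolding e_def[abs_def] by measurable
    have E: "has_bochner_integral lborel (\<lambda>x. normal_density 0 (sqrt (\<Delta> / 2)) x * e x) m"
    proof -
      have "- igbm_a \<tau> \<sigma> * \<Delta> / 2 + (sqrt (\<Delta> / 2))\<^sup>2 * \<sigma>\<^sup>2 / 2 = - \<Delta> / \<tau> / 2"
        using pos by (simp add: igbm_a_def field_simps)
      then show ?thesis
        using has_bochner_integral_normal_exp[of "sqrt (\<Delta> / 2)" "- igbm_a \<tau> \<sigma> * \<Delta> / 2" \<sigma>] pos
        unfolding e_def m_def by simp
    qed
    have EE: "has_bochner_integral lborel (\<lambda>x. normal_density 0 (sqrt (\<Delta> / 2)) x * (e x)\<^sup>2) r"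
    proof -
      have exponent: "(\<sigma>\<^sup>2 * \<Delta> - 2 * \<Delta> / \<tau>) / 2 = - igbm_a \<tau> \<sigma> * \<Delta> + (sqrt (\<Delta> / 2))\<^sup>2 * (2 * \<sigma>)\<^sup>2 / 2"
        using pos by (simp add: igbm_a_def power_mult_distrib field_simps)
      have square: "(e x)\<^sup>2 = exp (- igbm_a \<tau> \<sigma> * \<Delta> + 2 * \<sigma> * x)" for x
        unfolding e_def power2_eq_square exp_add[symmetric] by simp
      show ?thesis
        unfolding square r_def exponent using pos by (intro has_bochner_integral_normal_exp) simp
    qed
    have mx: "coef_mu_x s \<tau> \<sigma> \<Delta> = m * m" "coef_mu_h s \<tau> \<sigma> \<Delta> = m"
      and rx: "coef_r s \<tau> \<sigma> \<Delta> = r * r" "coef_r_h s \<tau> \<sigma> \<Delta> = r"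
      by (simp_all add: Strang2 coefs m_def r_def exp_add[symmetric] powr_def)
    have px: "coef_mu_x s \<tau> \<sigma> \<Delta> * coef_p s \<tau> \<sigma> \<Delta> = m * r"
    proof -
      have "coef_p s \<tau> \<sigma> \<Delta> = r * exp (\<Delta> / \<tau> / 2)"
        by (simp add: Strang2 coefs r_def powr_def)
      moreover have "m * exp (\<Delta> / \<tau> / 2) = 1" by (simp add: m_def exp_add[symmetric])
      ultimately show ?thesis unfolding mx(1) by (metis mult.assoc mult.commute mult.right_neutral)
    qed
    note prod = fp.has_bochner_integral_noise_mult
    show ?thesis
    proof (rule fp.scheme_formula_affine[where a = "\<lambda>f g. e f * e g" and h = "\<lambda>f g. e g"])
      show "has_bochner_integral M (\<lambda>\<omega>. e (\<phi> j \<omega>) * e (\<psi> j \<omega>)) (coef_mu_x s \<tau> \<sigma> \<Delta>)" for j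
        unfolding mx by (rule prod[OF em(1) em(1) phi[OF E em(1)] psi[OF E em(1)]])
      show "has_bochner_integral M (\<lambda>\<omega>. e (\<psi> j \<omega>)) (coef_mu_h s \<tau> \<sigma> \<Delta>)" for j
        unfolding mx by (rule psi[OF E em(1)])
      show "has_bochner_integral M (\<lambda>\<omega>. (e (\<phi> j \<omega>) * e (\<psi> j \<omega>))\<^sup>2) (coef_r s \<tau> \<sigma> \<Delta>)" for j
        unfolding rx power_mult_distrib by (rule prod[OF em(2) em(2) phi[OF EE em(2)] psi[OF EE em(2)]])
      show "has_bochner_integral M (\<lambda>\<omega>. (e (\<phi> j \<omega>) * e (\<psi> j \<omega>)) * e (\<psi> j \<omega>))
          (coef_mu_x s \<tau> \<sigma> \<Delta> * coef_p s \<tau> \<sigma> \<Delta>)" for j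
        unfolding px mult.assoc power2_eq_square[symmetric]
        by (rule prod[OF em(1) em(2) phi[OF E em(1)] psi[OF EE em(2)]])
      show "has_bochner_integral M (\<lambda>\<omega>. (e (\<psi> j \<omega>))\<^sup>2) (coef_r_h s \<tau> \<sigma> \<Delta>)" for j
        unfolding rx by (rule psi[OF EE em(2)])
      have ee: "exp (- igbm_a \<tau> \<sigma> * \<Delta> + \<sigma> * (x + y)) = e x * e y" for x y
        unfolding e_def exp_add[symmetric] by (simp add: algebra_simps)
      show "?Y (Suc j) \<omega> + coef_Z0 s \<mu> \<Delta> 0 =
          (e (\<phi> j \<omega>) * e (\<psi> j \<omega>)) * (?Y j \<omega> + coef_Z0 s \<mu> \<Delta> 0) + \<mu> * \<Delta> * e (\<psi> j \<omega>)" for j \<omega>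
        unfolding Strang2 sol ee coef_Z0_def scheme.case e_def[symmetric] by simp
      show "(\<lambda>(f :: real, g :: real). e f * e g) \<in> borel_measurable (borel \<Otimes>\<^sub>M borel)" by (rule mult2[OF em(1) em(1)])
      show "(\<lambda>(f :: real, g :: real). e g) \<in> borel_measurable (borel \<Otimes>\<^sub>M borel)" by (rule m2[OF em(1)])
    qed (simp_all add: Strang2 coefs one i1)
  next
    case Piecewise_Linear
    show ?thesis
    proof (rule xr.scheme_formula_affine[where a = "\<lambda>x q. ?X x" and h = "\<lambda>x q. ?\<alpha> x"])
      show "?Y (Suc j) \<omega> + coef_Z0 s \<mu> \<Delta> 0 = ?X (\<xi> j \<omega>) * (?Y j \<omega> + coef_Z0 s \<mu> \<Delta> 0) + \<mu> * \<Delta> * ?\<alpha> (\<xi> j \<omega>)" for j \<omega>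
        by (simp add: Piecewise_Linear coefs sol)
      show "(\<lambda>(x :: real, q :: real). ?X x) \<in> borel_measurable (borel \<Otimes>\<^sub>M borel)" by (rule m1[OF meas(1)])
      show "has_bochner_integral M (\<lambda>\<omega>. ?X (\<xi> j \<omega>)) (coef_mu_x s \<tau> \<sigma> \<Delta>)" for j
        using X[of j] unfolding coef_mu_x_def Piecewise_Linear scheme.case .
      show "has_bochner_integral M (\<lambda>\<omega>. (?X (\<xi> j \<omega>))\<^sup>2) (coef_r s \<tau> \<sigma> \<Delta>)" for j
        using XX[of j] unfolding coef_r_def Piecewise_Linear scheme.case .
      show "(\<lambda>(x :: real, q :: real). ?\<alpha> x) \<in> borel_measurable (borel \<Otimes>\<^sub>M borel)" by (rule m1[OF meas(2)])
      show "has_bochner_integral M (\<lambda>\<omega>. ?\<alpha> (\<xi> j \<omega>)) (coef_mu_h s \<tau> \<sigma> \<Delta>)" for j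
        using al[of j] unfolding coef_mu_h_def Piecewise_Linear scheme.case .
      show "has_bochner_integral M (\<lambda>\<omega>. ?X (\<xi> j \<omega>) * ?\<alpha> (\<xi> j \<omega>)) (coef_mu_x s \<tau> \<sigma> \<Delta> * coef_p s \<tau> \<sigma> \<Delta>)" for j
        using Xal[of j] unfolding coef_mu_x_def coef_p_def Piecewise_Linear scheme.case .
      show "has_bochner_integral M (\<lambda>\<omega>. (?\<alpha> (\<xi> j \<omega>))\<^sup>2) (coef_r_h s \<tau> \<sigma> \<Delta>)" for j
        using alal[of j] unfolding coef_r_h_def Piecewise_Linear scheme.case .
    qed (simp_all add: Piecewise_Linear coefs one i1)
  next
    case Log_ODE
    \<comment> \<open>\<beta> enters H and A H linearly and H^2 quadratically. So L and L tilde
      acquire the factor E \<beta> = 1 + \<sigma>^2 \<Delta> (1/20 + 1/30), and L bar the factor E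
      \<beta>^2.\<close>
    define \<beta> where "\<beta> q = 1 - \<sigma> * q + \<sigma>\<^sup>2 * (3 / 5 * q\<^sup>2 + \<Delta> / 30)" for q
    have bm [measurable]: "\<beta> \<in> borel_measurable borel" "(\<lambda>q. (\<beta> q)\<^sup>2) \<in> borel_measurable borel"
      unfolding \<beta>_def[abs_def] by measurable
    have s4: "sqrt (\<Delta> / 12) ^ 4 = \<Delta>\<^sup>2 / 144"
    proof -
      have "sqrt (\<Delta> / 12) ^ 4 = ((sqrt (\<Delta> / 12))\<^sup>2)\<^sup>2" unfolding power_mult[symmetric] by simp
      then show ?thesis using pos by (simp add: power_divide)
    qed
    have B: "has_bochner_integral M (\<lambda>\<omega>. \<beta> (\<rho> j \<omega>)) (1 + \<sigma>\<^sup>2 * \<Delta> / 12)" for j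
    proof (rule rho[OF _ bm(1)])
      have "\<beta> x = (1 + \<sigma>\<^sup>2 * \<Delta> / 30) + - \<sigma> * x + 3 / 5 * \<sigma>\<^sup>2 * x\<^sup>2 + 0 * x ^ 3 + 0 * x ^ 4" for x
        unfolding \<beta>_def by (simp add: algebra_simps)
      moreover have "(1 + \<sigma>\<^sup>2 * \<Delta> / 30) + 3 / 5 * \<sigma>\<^sup>2 * (sqrt (\<Delta> / 12))\<^sup>2 + 3 * 0 * sqrt (\<Delta> / 12) ^ 4 = 1 + \<sigma>\<^sup>2 * \<Delta> / 12"
        using pos by simp
      ultimately show "has_bochner_integral lborel (\<lambda>x. normal_density 0 (sqrt (\<Delta> / 12)) x * \<beta> x) (1 + \<sigma>\<^sup>2 * \<Delta> / 12)"
        using has_bochner_integral_normal_quartic[of "sqrt (\<Delta> / 12)" "1 + \<sigma>\<^sup>2 * \<Delta> / 30" "- \<sigma>" "3 / 5 * \<sigma>\<^sup>2" 0 0] pos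
        by (simp only:) simp
    qed
    have BB: "has_bochner_integral M (\<lambda>\<omega>. (\<beta> (\<rho> j \<omega>))\<^sup>2) (1 + \<sigma>\<^sup>2 * \<Delta> / 4 + 43 / 3600 * \<sigma> ^ 4 * \<Delta>\<^sup>2)" for j
    proof (rule rho[OF _ bm(2)])
      let ?k = "1 + \<sigma>\<^sup>2 * \<Delta> / 30"
      let ?e = "\<sigma>\<^sup>2 + 6 / 5 * ?k * \<sigma>\<^sup>2" and ?g = "9 / 25 * \<sigma> ^ 4"
      have eq: "(\<beta> x)\<^sup>2 = ?k\<^sup>2 + (- 2 * ?k * \<sigma>) * x + ?e * x\<^sup>2 + (- (6 / 5) * \<sigma> ^ 3) * x ^ 3 + ?g * x ^ 4" for x
        unfolding \<beta>_def by (simp add: power2_eq_square power3_eq_cube power4_eq_xxxx algebra_simps)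
      have s2: "(sqrt (\<Delta> / 12))\<^sup>2 = \<Delta> / 12" using pos by simp
      \<comment> \<open>The constant 43/3600 is 1/900 from the squared constant term, 1/300 from the
        quadratic coefficient and 27/3600 from the fourth moment \<Delta>^2 / 48.\<close>
      have val: "?k\<^sup>2 + ?e * (sqrt (\<Delta> / 12))\<^sup>2 + 3 * ?g * sqrt (\<Delta> / 12) ^ 4 =
          1 + \<sigma>\<^sup>2 * \<Delta> / 4 + 43 / 3600 * \<sigma> ^ 4 * \<Delta>\<^sup>2"
        unfolding s2 s4 by (simp add: power2_eq_square power4_eq_xxxx algebra_simps)
      show "has_bochner_integral lborel (\<lambda>x. normal_density 0 (sqrt (\<Delta> / 12)) x * (\<beta> x)\<^sup>2)
          (1 + \<sigma>\<^sup>2 * \<Delta> / 4 + 43 / 3600 * \<sigma> ^ 4 * \<Delta>\<^sup>2)"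
        unfolding eq val[symmetric] using pos by (intro has_bochner_integral_normal_quartic) simp
    qed
    note prod = xr.has_bochner_integral_noise_mult
    show ?thesis
    proof (rule xr.scheme_formula_affine[where a = "\<lambda>x q. ?X x" and h = "\<lambda>x q. ?\<alpha> x * \<beta> q"])
      show "has_bochner_integral M (\<lambda>\<omega>. ?\<alpha> (\<xi> j \<omega>) * \<beta> (\<rho> j \<omega>)) (coef_mu_h s \<tau> \<sigma> \<Delta>)" for j
        unfolding coef_mu_h_def Log_ODE scheme.case igbm_K_def
        by (rule prod[OF igbm_alpha_measurable bm(1) al B])
      show "has_bochner_integral M (\<lambda>\<omega>. ?X (\<xi> j \<omega>) * (?\<alpha> (\<xi> j \<omega>) * \<beta> (\<rho> j \<omega>)))
          (coef_mu_x s \<tau> \<sigma> \<Delta> * coef_p s \<tau> \<sigma> \<Delta>)" for j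
        unfolding coef_mu_x_def coef_p_def Log_ODE scheme.case igbm_K_tilde_def mult.assoc[symmetric]
        by (rule prod[OF _ bm(1) Xal B]) measurable
      show "has_bochner_integral M (\<lambda>\<omega>. (?\<alpha> (\<xi> j \<omega>) * \<beta> (\<rho> j \<omega>))\<^sup>2) (coef_r_h s \<tau> \<sigma> \<Delta>)" for j
        unfolding coef_r_h_def Log_ODE scheme.case igbm_K_bar_def power_mult_distrib
        by (rule prod[OF _ bm(2) alal BB]) measurable
      show "?Y (Suc j) \<omega> + coef_Z0 s \<mu> \<Delta> 0 =
          ?X (\<xi> j \<omega>) * (?Y j \<omega> + coef_Z0 s \<mu> \<Delta> 0) + \<mu> * \<Delta> * (?\<alpha> (\<xi> j \<omega>) * \<beta> (\<rho> j \<omega>))" for j \<omega>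
        unfolding Log_ODE sol coef_Z0_def scheme.case \<beta>_def[symmetric] by simp
      show "(\<lambda>(x :: real, q :: real). ?X x) \<in> borel_measurable (borel \<Otimes>\<^sub>M borel)" by (rule m1[OF meas(1)])
      show "has_bochner_integral M (\<lambda>\<omega>. ?X (\<xi> j \<omega>)) (coef_mu_x s \<tau> \<sigma> \<Delta>)" for j
        using X[of j] unfolding coef_mu_x_def Log_ODE scheme.case .
      show "has_bochner_integral M (\<lambda>\<omega>. (?X (\<xi> j \<omega>))\<^sup>2) (coef_r s \<tau> \<sigma> \<Delta>)" for j
        using XX[of j] unfolding coef_r_def Log_ODE scheme.case .
      show "(\<lambda>(x :: real, q :: real). ?\<alpha> x * \<beta> q) \<in> borel_measurable (borel \<Otimes>\<^sub>M borel)" by (rule mult2[OF meas(2) bm(1)])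
    qed (simp_all add: Log_ODE coefs one i1)
  qed
  then show ?thesis unfolding scheme_formula_def Let_def .
qed

end
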